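(* Consider the bilinear system \[ \dot x(t) = Ax(t) + Bu(t) + \sum_{k=1}^m N_k x(t) u_k(t),\qquad y(t) = Cx(t),\quad t\ge 0, \] with $A, N_k\in\mathbb R^{n\times n}$, $B\in\mathbb R^{n\times m}$, $C\in\mathbb R^{p\times n}$, $u\in L^2$, and assume \[ \sigma\Big(A\otimes I+I\otimes A+ \sum_{k=1}^m N_k \otimes N_k\Big)\subset \mathbb C_- . \] Assume the realization $(A,B,C,N_k)$ is balanced, i.e. $P=Q=\Sigma=\operatorname{diag}(\sigma_1,\ldots,\sigma_n)>0$, where $P$ and $Q$ solve \[ A P + P A^T + \sum_{k=1}^m N_k P N_k^T = - B B^T,\qquad A^T Q + Q A + \sum_{k=1}^m N_k^T Q N_k = - C^T C, \] and partition \[ A=\begin{pmatrix}A_{11}&A_{12}\\ A_{21}&A_{22}\end{pmatrix},\ B=\begin{pmatrix}B_1\\ B_2\end{pmatrix},\ C=\begin{pmatrix}C_1& C_2\end{pmatrix},\ N_k=\begin{pmatrix}N_{k,11}&N_{k,12}\\ N_{k,21}&N_{k,22}\end{pmatrix},\ \Sigma=\begin{pmatrix}\Sigma_1&\\ &\Sigma_2\end{pmatrix}, \] with $A_{11}\in\mathbb R^{r\times r}$, $\Sigma_1\in\mathbb R^{r\times r}$, $\Sigma_2=\operatorname{diag}(\sigma_{r+1},\ldots,\sigma_n)$. Let $\hat y$ be the output of the reduced bilinear system $\dot{\hat x}=\hat A\hat x+\hat B u+\sum_{k=1}^m \hat N_k\hat x u_k$, $\hat y=\hat C\hat x$ with the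 balanced truncation matrices $(\hat A,\hat B,\hat C,\hat N_k)=(A_{11},B_1,C_1,N_{k,11})$. Then, with zero initial conditions for both the full and the reduced system, \[ \sup_{t\geq 0}\left\|y(t)-\hat y(t)\right\|_2 \leq \left(\operatorname{tr}(\Sigma_2 K_{BT})\right)^{\frac{1}{2}} \exp\left\{0.5\left\|u^{0}\right\|_{L^2}^2\right\} \left\|u\right\|_{L^2}, \] where \[ K_{BT} = B_2 B_2^T+2 P_{g,2}A_{21}^T +\sum_{k=1}^m \big(2 N_{k,22} P_{g,2}N_{k,21}^T+2 N_{k,21} P_{g,1}N_{k,21}^T-N_{k,21} \hat P N_{k,21}^T\big), \] $\hat P$ solves $\hat A \hat P + \hat P \hat A^T + \sum_{k=1}^m \hat N_k \hat P \hat N_k^T = - \hat B \hat B^T$, and $P_g=\begin{pmatrix}P_{g,1}\\ P_{g,2}\end{pmatrix}$ (with $P_{g,1}\in\mathbb R^{r\times r}$) solves $A P_g + P_g \hat A^T + \sum_{k=1}^m N_k P_g \hat N_k^T = - B \hat B^T$.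
   Context: Here $\|u\|_{L^2}^2=\int_0^\infty u^T(s)u(s)\,ds$, and $u^0=(u^0_1,\ldots,u^0_m)^T$ is the vector of control components with nonzero $N_k$: $u^0_k\equiv 0$ if $N_k=0$ and $u^0_k=u_k$ otherwise. $\mathbb C_-$ denotes the open left half complex plane. *)

theory Defs
  imports "HOL-Analysis.Analysis" "Jordan_Normal_Form.Matrix" "Jordan_Normal_Form.Char_Poly"
begin

definition blk :: "real mat \<Rightarrow> nat \<Rightarrow> nat \<Rightarrow> nat \<Rightarrow> nat \<Rightarrow> real mat" where
  "blk M i0 j0 nr nc = mat nr nc (\<lambda>(i,j). M $$ (i0 + i, j0 + j))"

definition msum :: "nat \<Rightarrow> nat \<Rightarrow> (nat \<Rightarrow> real mat) \<Rightarrow> nat \<Rightarrow> real mat" where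
  "msum nr nc f m = mat nr nc (\<lambda>ij. \<Sum>k<m. f k $$ ij)"

definition kron :: "real mat \<Rightarrow> real mat \<Rightarrow> real mat" where
  "kron X Y = mat (dim_row X * dim_row Y) (dim_col X * dim_col Y)
     (\<lambda>(i,j). X $$ (i div dim_row Y, j div dim_col Y) * Y $$ (i mod dim_row Y, j mod dim_col Y))"

definition mtrace :: "real mat \<Rightarrow> real" where
  "mtrace M = (\<Sum>i<dim_row M. M $$ (i,i))"

definition spec_in_lhp :: "real mat \<Rightarrow> bool" where
  "spec_in_lhp M \<longleftrightarrow> (\<forall>z. eigenvalue (map_mat complex_of_real M) z \<longrightarrow> Re z < 0)"

definition is_L2_input :: "nat \<Rightarrow> (real \<Rightarrow> real vec) \<Rightarrow> bool" where
  "is_L2_input m u \<longleftrightarrow> (\<forall>t\<ge>0. u t \<in> carrier_vec m) \<and>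
     (\<forall>k<m. (\<lambda>s. u s $ k) measurable_on {0..} \<and> (\<lambda>s. (u s $ k)^2) integrable_on {0..})"

definition L2sq :: "nat \<Rightarrow> (nat \<Rightarrow> bool) \<Rightarrow> (real \<Rightarrow> real vec) \<Rightarrow> real" where
  "L2sq m S u = integral {0..} (\<lambda>s. \<Sum>k\<in>{k. k < m \<and> S k}. (u s $ k)^2)"

text \<open>x is a (Caratheodory) solution of x' = A x + B u + sum_k N_k x u_k on [0,\<infinity>) with x(0) = 0,
  i.e. x(t) = integral_0^t (A x + B u + sum_k N_k x u_k) ds for all t \<ge> 0.\<close>
definition bilin_sol :: "real mat \<Rightarrow> real mat \<Rightarrow> (nat \<Rightarrow> real mat) \<Rightarrow> nat \<Rightarrow>
    (real \<Rightarrow> real vec) \<Rightarrow> (real \<Rightarrow> real vec) \<Rightarrow> bool" where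
  "bilin_sol A B N m u x \<longleftrightarrow> (\<forall>t\<ge>0. x t \<in> carrier_vec (dim_row A)) \<and>
     (\<forall>t\<ge>0. \<forall>i<dim_row A.
        ((\<lambda>s. (A *\<^sub>v x s) $ i + (B *\<^sub>v u s) $ i + (\<Sum>k<m. u s $ k * (N k *\<^sub>v x s) $ i))
          has_integral (x t $ i)) {0..t})"

definition vnorm2 :: "real vec \<Rightarrow> real" where
  "vnorm2 v = sqrt (\<Sum>i<dim_vec v. (v $ i)^2)"

end

theory Submission
  imports Defs
begin

text \<open>
  The output error is the output of the error system with state \<open>z = (x, xh)\<close>. Let \<open>Y\<close> solve
  \<open>Y' = L\<^sup>* Y\<close>, \<open>Y 0 = C\<^sup>T C\<close>, where \<open>L\<^sup>*\<close> is the adjoint of the generalised Lyapunov operator of the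
  error system, and let \<open>\<gamma> = tr (P Y)\<close> for the Gramian \<open>P\<close> of the error system. Then \<open>Y\<close> stays positive
  semidefinite and \<open>\<gamma>' = - tr (B\<^sup>T Y B)\<close>, so along a trajectory the function
  \<open>z(s)\<^sup>T Y(T - s) z(s) / \<gamma>(T - s)\<close>, damped by \<open>exp (- \<integral> \<bar>u\<^sup>0\<bar>\<^sup>2)\<close>, grows at most at rate \<open>\<bar>u\<bar>\<^sup>2\<close>.
  At \<open>s = T\<close> this bounds the squared output error by \<open>\<gamma>(0)\<close> times the exponential factor times
  \<open>\<parallel>u\<parallel>\<^sup>2\<close>, and the balancing equations turn \<open>\<gamma>(0) = tr (C P C\<^sup>T)\<close> into \<open>tr (\<Sigma>\<^sub>2 K\<^sub>B\<^sub>T)\<close>.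
  Nonnegativity of \<open>\<gamma>\<close> comes from the supersolution \<open>2 diag (\<Sigma>, \<Sigma>\<^sub>1)\<close> of the adjoint Lyapunov equation.
\<close>

subsection \<open>Linear ODEs and absolutely continuous functions\<close>


text \<open>Two obstacles shape the argument. \<open>Pg\<close> and \<open>Phat\<close> are only
  known to solve their equations, so the sign of the trace pairing of the error Gramian with a
  positive semidefinite matrix is not visible; it has to be forced by the long-time behaviour of the
  flow. And the control is merely square integrable, so the state obeys its equation only in
  integrated form; differentiation along a trajectory therefore goes through
  \<open>has_density\<close>. Origin of the constants: tr (B^T Y B) is the rate at which gamma
  decreases, and it is also the coefficient that Cauchy-Schwarz leaves in front of z^T Y z when the
  input term is estimated with weight gamma. Division by gamma cancels the two and leaves |u|^2 with
  factor one. The bilinear terms are absorbed by completing a square with the N_k^T Y N_k part of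
  the adjoint operator. This costs u_k^2 z^T Y z, and nothing when N_k = 0, which is why only u^0
  enters the exponential. The factor 0.5 appears when the root of the squared estimate is
  taken.\<close>

lemma linear_ode_solution_exists:
  fixes l :: "'j \<Rightarrow> 'j \<Rightarrow> real" and y0 :: "'j \<Rightarrow> real"
  assumes fin: "finite J"
  shows "\<exists>y. (\<forall>j. y 0 j = y0 j) \<and>
    (\<forall>t. \<forall>j\<in>J. ((\<lambda>s. y s j) has_real_derivative (\<Sum>q\<in>J. l j q * y t q)) (at t))"
proof -
  define L where "L f j = (\<Sum>q\<in>J. l j q * f q)" for f :: "'j \<Rightarrow> real" and j
  \<comment> \<open>The solution is the exponential series exp (t L) y0. Here \<open>it k\<close> is
    L^k y0, so every coordinate is a real power series in t and can be differentiated
    termwise.\<close>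
  define it where "it k = (L ^^ k) y0" for k
  \<comment> \<open>The sum of all absolute entries dominates every row sum, so L^k y0 grows at most
    like c K^k and the exponential series is a majorant.\<close>
  define K where "K = (\<Sum>j\<in>J. \<Sum>q\<in>J. \<bar>l j q\<bar>)"
  define c where "c = (\<Sum>q\<in>J. \<bar>y0 q\<bar>)"
  define y where "y t j = (\<Sum>k. it k j / fact k * t ^ k)" for t :: real and j
  have it_Suc: "it (Suc k) j = (\<Sum>q\<in>J. l j q * it k q)" for k j
    by (simp add: it_def L_def)
  have K0: "K \<ge> 0" by (auto simp: K_def intro!: sum_nonneg)
  have c0: "c \<ge> 0" by (auto simp: c_def intro!: sum_nonneg)
  have row: "(\<Sum>q\<in>J. \<bar>l j q\<bar>) \<le> K" if "j \<in> J" for j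
    unfolding K_def using that fin
    by (intro member_le_sum[of j J "\<lambda>j. \<Sum>q\<in>J. \<bar>l j q\<bar>"]) (auto intro!: sum_nonneg)
  have bound: "\<bar>it k j\<bar> \<le> c * K ^ k" if "j \<in> J" for k j
    using that
  proof (induction k arbitrary: j)
    case 0
    then show ?case
      using member_le_sum[of j J "\<lambda>q. \<bar>y0 q\<bar>"] fin by (simp add: it_def c_def)
  next
    case (Suc k)
    have "\<bar>it (Suc k) j\<bar> \<le> (\<Sum>q\<in>J. \<bar>l j q\<bar> * \<bar>it k q\<bar>)"
      unfolding it_Suc by (rule order_trans[OF sum_abs]) (simp add: abs_mult)
    also have "\<dots> \<le> (\<Sum>q\<in>J. \<bar>l j q\<bar> * (c * K ^ k))"
      using Suc by (intro sum_mono mult_left_mono) auto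
    also have "\<dots> = (\<Sum>q\<in>J. \<bar>l j q\<bar>) * (c * K ^ k)"
      by (simp add: sum_distrib_right)
    also have "\<dots> \<le> K * (c * K ^ k)"
      using row[OF Suc.prems] K0 c0 by (intro mult_right_mono) auto
    finally show ?case by (simp add: algebra_simps)
  qed
  have summ: "summable (\<lambda>k. it k j / fact k * t ^ k)" if "j \<in> J" for j and t :: real
  proof (rule summable_comparison_test')
    show "summable (\<lambda>k. c * ((K * \<bar>t\<bar>) ^ k /\<^sub>R fact k))"
      by (intro summable_mult summable_exp_generic)
    fix k :: nat
    have "norm (it k j / fact k * t ^ k) = \<bar>it k j\<bar> * (\<bar>t\<bar> ^ k / fact k)"
      by (simp add: abs_mult power_abs)
    also have "\<dots> \<le> (c * K ^ k) * (\<bar>t\<bar> ^ k / fact k)"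
      by (intro mult_right_mono bound that) auto
    finally show "norm (it k j / fact k * t ^ k) \<le> c * ((K * \<bar>t\<bar>) ^ k /\<^sub>R fact k)"
      by (simp add: power_mult_distrib field_simps)
  qed
  have "((\<lambda>s. y s j) has_real_derivative (\<Sum>q\<in>J. l j q * y t q)) (at t)" if j: "j \<in> J" for t j
  proof -
    have "((\<lambda>s. y s j) has_real_derivative (\<Sum>k. diffs (\<lambda>k. it k j / fact k) k * t ^ k)) (at t)"
      unfolding y_def by (rule termdiffs_strong_converges_everywhere) (rule summ[OF j])
    also have "(\<Sum>k. diffs (\<lambda>k. it k j / fact k) k * t ^ k)
        = (\<Sum>k. \<Sum>q\<in>J. l j q * (it k q / fact k * t ^ k))"
    proof (rule suminf_cong)
      fix k
      have "diffs (\<lambda>k. it k j / fact k) k = it (Suc k) j / fact k"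
        by (simp add: diffs_def field_simps del: of_nat_Suc)
      then show "diffs (\<lambda>k. it k j / fact k) k * t ^ k = (\<Sum>q\<in>J. l j q * (it k q / fact k * t ^ k))"
        unfolding it_Suc by (simp add: sum_distrib_left sum_divide_distrib mult_ac)
    qed
    also have "\<dots> = (\<Sum>q\<in>J. \<Sum>k. l j q * (it k q / fact k * t ^ k))"
      by (rule suminf_sum) (intro summable_mult summ)
    also have "\<dots> = (\<Sum>q\<in>J. l j q * y t q)"
      unfolding y_def by (intro sum.cong refl suminf_mult summ)
    finally show ?thesis .
  qed
  moreover have "y 0 j = y0 j" for j
  proof -
    have "(\<lambda>k. it k j / fact k * 0 ^ k) sums (it 0 j / fact 0)"
      using powser_sums_zero[of "\<lambda>k. it k j / fact k"] by simp
    then show ?thesis by (simp add: y_def it_def sums_iff)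
  qed
  ultimately show ?thesis by blast
qed

text \<open>Absolute continuity on [0,T] with almost-everywhere derivative \<open>f'\<close>, in
  integrated form because this is all that the state equation provides. Absolute integrability is
  demanded since gauge integrability alone does not survive multiplication by a continuous
  function.\<close>

definition has_density :: "real \<Rightarrow> (real \<Rightarrow> real) \<Rightarrow> (real \<Rightarrow> real) \<Rightarrow> bool" where
  "has_density T f f' \<longleftrightarrow> f' absolutely_integrable_on {0..T} \<and>
     (\<forall>t\<in>{0..T}. (f' has_integral (f t - f 0)) {0..t})"

lemma has_density_integral:
  assumes "has_density T f f'" "0 \<le> s" "s \<le> t" "t \<le> T"
  shows "(f' has_integral (f t - f s)) {s..t}"
proof -
  have t: "(f' has_integral (f t - f 0)) {0..t}" and s: "(f' has_integral (f s - f 0)) {0..s}"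
    using assms by (auto simp: has_density_def)
  have int: "f' integrable_on {s..t}"
    using t assms(2,3) by (meson atLeastatMost_subset_iff has_integral_integrable integrable_on_subinterval order_refl)
  have "(f' has_integral ((f s - f 0) + integral {s..t} f')) {0..t}"
    using has_integral_combine[OF assms(2,3) s integrable_integral[OF int]] .
  then have "f t - f 0 = (f s - f 0) + integral {s..t} f'"
    using t has_integral_unique by blast
  then show ?thesis
    using integrable_integral[OF int] by (simp add: algebra_simps)
qed

lemma has_density_cong:
  assumes "has_density T f f'" "\<And>t. t \<in> {0..T} \<Longrightarrow> f t = g t" "\<And>t. t \<in> {0..T} \<Longrightarrow> f' t = g' t"
  shows "has_density T g g'"
proof -
  have "(g' has_integral (g t - g 0)) {0..t}" if "t \<in> {0..T}" for t
  proof -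
    have "(f' has_integral (f t - f 0)) {0..t}"
      using assms(1) that by (auto simp: has_density_def)
    then have "(g' has_integral (f t - f 0)) {0..t}"
      by (rule has_integral_eq[rotated]) (use assms(3) that in auto)
    then show ?thesis using assms(2)[of t] assms(2)[of 0] that by auto
  qed
  moreover have "g' absolutely_integrable_on {0..T}"
    using assms(1,3) absolutely_integrable_spike[where f=f' and g=g' and T="{0..T}" and S="{}"]
    by (auto simp: has_density_def)
  ultimately show ?thesis by (auto simp: has_density_def)
qed

lemma has_density_continuous:
  assumes "has_density T f f'"
  shows "continuous_on {0..T} f"
proof -
  have "f' integrable_on {0..T}"
    using assms set_lebesgue_integral_eq_integral(1) by (auto simp: has_density_def)
  then have "continuous_on {0..T} (\<lambda>t. f 0 + integral {0..t} f')"
    by (intro continuous_intros indefinite_integral_continuous_1)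
  moreover have "f 0 + integral {0..t} f' = f t" if "t \<in> {0..T}" for t
  proof -
    have "(f' has_integral (f t - f 0)) {0..t}" using assms that by (simp add: has_density_def)
    from integral_unique[OF this] show ?thesis by simp
  qed
  ultimately show ?thesis by (rule continuous_on_eq)
qed

lemma has_density_sum:
  assumes "finite J" "\<And>j. j \<in> J \<Longrightarrow> has_density T (f j) (f' j)"
  shows "has_density T (\<lambda>t. \<Sum>j\<in>J. f j t) (\<lambda>t. \<Sum>j\<in>J. f' j t)"
  using assms unfolding has_density_def
  by (auto simp: sum_subtractf[symmetric] intro!: absolutely_integrable_sum has_integral_sum)

lemma has_density_C1:
  assumes "\<And>t. t \<in> {0..T} \<Longrightarrow> (f has_real_derivative f' t) (at t)" "continuous_on {0..T} f'"
  shows "has_density T f f'"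
  unfolding has_density_def
proof (intro conjI ballI)
  show "f' absolutely_integrable_on {0..T}"
    using assms(2) by (rule absolutely_integrable_continuous_real)
  fix t assume "t \<in> {0..T}"
  then show "(f' has_integral (f t - f 0)) {0..t}"
    by (intro fundamental_theorem_of_calculus)
      (auto simp: has_real_derivative_iff_has_vector_derivative[symmetric]
        intro!: has_field_derivative_at_within assms(1))
qed

lemma absolutely_integrable_continuous_mult:
  fixes f g :: "real \<Rightarrow> real"
  assumes "continuous_on {a..b} f" "g absolutely_integrable_on {a..b}"
  shows "(\<lambda>x. f x * g x) absolutely_integrable_on {a..b}"
  using assms
  by (intro absolutely_integrable_bounded_measurable_product_real
      continuous_imp_measurable_on_sets_lebesgue compact_imp_bounded compact_continuous_image) auto

text \<open>A function whose increments over short intervals are dominated by an arbitrarily small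
  multiple of the increments of a fixed function is constant; the product and exponential rules
  for densities are obtained by applying this to the difference of the two sides.\<close>

lemma constant_if_small_increments:
  fixes D H :: "real \<Rightarrow> real"
  assumes T: "0 \<le> T"
    and small: "\<And>e. e > 0 \<Longrightarrow> \<exists>d>0. \<forall>s t. 0 \<le> s \<and> s \<le> t \<and> t \<le> T \<and> t - s < d \<longrightarrow>
      \<bar>D t - D s\<bar> \<le> e * (H t - H s)"
  shows "D T = D 0"
proof -
  have le: "\<bar>D T - D 0\<bar> \<le> e * (H T - H 0)" if "e > 0" for e
  proof -
    obtain d where d: "d > 0"
      "\<And>s t. 0 \<le> s \<Longrightarrow> s \<le> t \<Longrightarrow> t \<le> T \<Longrightarrow> t - s < d \<Longrightarrow> \<bar>D t - D s\<bar> \<le> e * (H t - H s)"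
      using small[OF \<open>e > 0\<close>] by metis
    obtain k :: nat where "T / d < real k" using reals_Archimedean2 by blast
    then have k: "T < real (Suc k) * d" using d(1) by (simp add: field_simps)
    define p where "p i = T * real i / real (Suc k)" for i
    have step: "\<bar>D (p (Suc i)) - D (p i)\<bar> \<le> e * (H (p (Suc i)) - H (p i))" if "i < Suc k" for i
    proof (rule d(2))
      show "0 \<le> p i" using T by (simp add: p_def)
      show "p i \<le> p (Suc i)" using T by (auto simp: p_def intro!: divide_right_mono mult_left_mono)
      have "T * real (Suc i) \<le> T * real (Suc k)" using T that by (intro mult_left_mono) auto
      then show "p (Suc i) \<le> T" by (simp add: p_def divide_le_eq del: of_nat_Suc)
      have "p (Suc i) - p i = T / real (Suc k)"
        by (simp add: p_def diff_divide_distrib[symmetric] algebra_simps)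
      also have "\<dots> < d" using k by (simp add: divide_less_eq mult.commute del: of_nat_Suc)
      finally show "p (Suc i) - p i < d" .
    qed
    have "\<bar>D T - D 0\<bar> = \<bar>\<Sum>i<Suc k. D (p (Suc i)) - D (p i)\<bar>"
      by (subst sum_lessThan_telescope) (simp add: p_def del: of_nat_Suc)
    also have "\<dots> \<le> (\<Sum>i<Suc k. \<bar>D (p (Suc i)) - D (p i)\<bar>)" by (rule sum_abs)
    also have "\<dots> \<le> (\<Sum>i<Suc k. e * (H (p (Suc i)) - H (p i)))"
      by (intro sum_mono step) auto
    also have "\<dots> = e * (H T - H 0)"
      by (subst sum_distrib_left[symmetric], subst sum_lessThan_telescope)
        (simp add: p_def del: of_nat_Suc)
    finally show ?thesis .
  qed
  have "\<bar>D T - D 0\<bar> \<le> 0"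
  proof (rule field_le_epsilon)
    fix e :: real assume "e > 0"
    \<comment> \<open>The summand 1 keeps the divisor positive when \<open>H T\<close> equals
      \<open>H 0\<close>.\<close>
    define c where "c = \<bar>H T - H 0\<bar> + 1"
    have "\<bar>D T - D 0\<bar> \<le> e / c * (H T - H 0)" using le[of "e / c"] \<open>e > 0\<close> by (simp add: c_def)
    also have "\<dots> \<le> e / c * c" using \<open>e > 0\<close> by (intro mult_left_mono) (auto simp: c_def)
    also have "\<dots> = e" by (simp add: c_def)
    finally show "\<bar>D T - D 0\<bar> \<le> 0 + e" by simp
  qed
  then show ?thesis by simp
qed

lemma has_integral_abs_bound:
  fixes f g :: "real \<Rightarrow> real"
  assumes "(f has_integral i) S" "(g has_integral j) S" "\<And>x. x \<in> S \<Longrightarrow> \<bar>f x\<bar> \<le> g x"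
  shows "\<bar>i\<bar> \<le> j"
  using has_integral_norm_bound_integral_component[OF assms(1,2), of 1] assms(3) by simp

lemma uniform_oscillation:
  fixes f :: "real \<Rightarrow> real"
  assumes "continuous_on {0..T} f" "e > 0"
  obtains d where "d > 0" "\<And>s t. s \<in> {0..T} \<Longrightarrow> t \<in> {0..T} \<Longrightarrow> \<bar>t - s\<bar> < d \<Longrightarrow> \<bar>f t - f s\<bar> < e"
proof -
  have "uniformly_continuous_on {0..T} f"
    by (rule compact_uniformly_continuous[OF assms(1)]) simp
  then obtain d where "d > 0" "\<forall>s\<in>{0..T}. \<forall>t\<in>{0..T}. dist t s < d \<longrightarrow> dist (f t) (f s) < e"
    using assms(2) unfolding uniformly_continuous_on_def by meson
  then show ?thesis using that[of d] by (simp add: dist_real_def)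
qed

lemma has_density_indefinite_integral:
  assumes "h absolutely_integrable_on {0..T}"
  shows "has_density T (\<lambda>t. integral {0..t} h) h"
proof -
  have "h integrable_on {0..T}"
    using assms set_lebesgue_integral_eq_integral(1) by blast
  then have "(h has_integral integral {0..t} h) {0..t}" if "t \<in> {0..T}" for t
    using that integrable_on_subinterval[of h "{0..T}" 0 t] by (auto intro!: integrable_integral)
  with assms show ?thesis by (auto simp: has_density_def)
qed

lemma has_density_mult:
  assumes f: "has_density T f f'" and g: "has_density T g g'"
  shows "has_density T (\<lambda>t. f t * g t) (\<lambda>t. f' t * g t + f t * g' t)"
proof -
  let ?h = "\<lambda>t. f' t * g t + f t * g' t"
  have cf: "continuous_on {0..T} f" and cg: "continuous_on {0..T} g"
    using f g has_density_continuous by auto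
  have h_abs: "?h absolutely_integrable_on {0..T}"
    using absolutely_integrable_continuous_mult[OF cf, of g']
      absolutely_integrable_continuous_mult[OF cg, of f'] f g
    by (auto simp: has_density_def mult.commute intro!: set_integral_add(1))
  note Hd = has_density_indefinite_integral[OF h_abs]
  define D where "D t = f t * g t - integral {0..t} ?h" for t
  define F where "F t = integral {0..t} (\<lambda>s. \<bar>f' s\<bar>)" for t
  define G where "G t = integral {0..t} (\<lambda>s. \<bar>g' s\<bar>)" for t
  have F: "has_density T F (\<lambda>s. \<bar>f' s\<bar>)" and G: "has_density T G (\<lambda>s. \<bar>g' s\<bar>)"
    unfolding F_def G_def using f g absolutely_integrable_norm[where f=f' and S="{0..T}"] absolutely_integrable_norm[where f=g' and S="{0..T}"]
    by (auto simp: has_density_def[of T f] has_density_def[of T g] o_def intro!: has_density_indefinite_integral)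
  have "D t0 = D 0" if t0: "t0 \<in> {0..T}" for t0
  proof (rule constant_if_small_increments[where H="\<lambda>t. F t + G t"])
    show "0 \<le> t0" using t0 by simp
    fix e :: real assume "e > 0"
    obtain d1 where d1: "d1 > 0" "\<And>s t. s \<in> {0..T} \<Longrightarrow> t \<in> {0..T} \<Longrightarrow> \<bar>t - s\<bar> < d1 \<Longrightarrow> \<bar>f t - f s\<bar> < e"
      using uniform_oscillation[OF cf \<open>e > 0\<close>] by metis
    obtain d2 where d2: "d2 > 0" "\<And>s t. s \<in> {0..T} \<Longrightarrow> t \<in> {0..T} \<Longrightarrow> \<bar>t - s\<bar> < d2 \<Longrightarrow> \<bar>g t - g s\<bar> < e"
      using uniform_oscillation[OF cg \<open>e > 0\<close>] by metis
    have "\<bar>D t - D s\<bar> \<le> e * ((F t + G t) - (F s + G s))"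
      if st: "0 \<le> s" "s \<le> t" "t \<le> t0" "t - s < min d1 d2" for s t
    proof -
      have tT: "t \<le> T" using st t0 by simp
      note h = has_density_integral[OF Hd st(1,2) tT]
      have "((\<lambda>x. f' x * g t + f s * g' x) has_integral ((f t - f s) * g t + f s * (g t - g s))) {s..t}"
        by (intro has_integral_add has_integral_mult_left has_integral_mult_right
            has_density_integral[OF f] has_density_integral[OF g] st tT)
      from has_integral_diff[OF this h]
      have I: "((\<lambda>x. f' x * (g t - g x) + g' x * (f s - f x)) has_integral (D t - D s)) {s..t}"
        by (simp add: D_def algebra_simps)
      have J: "((\<lambda>x. e * (\<bar>f' x\<bar> + \<bar>g' x\<bar>)) has_integral (e * ((F t - F s) + (G t - G s)))) {s..t}"
        by (intro has_integral_add has_integral_mult_right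
            has_density_integral[OF F] has_density_integral[OF G] st tT)
      have "\<bar>D t - D s\<bar> \<le> e * ((F t - F s) + (G t - G s))"
      proof (rule has_integral_abs_bound[OF I J])
        fix x assume x: "x \<in> {s..t}"
        have "\<bar>f' x * (g t - g x) + g' x * (f s - f x)\<bar>
            \<le> \<bar>f' x\<bar> * \<bar>g t - g x\<bar> + \<bar>g' x\<bar> * \<bar>f s - f x\<bar>"
          by (rule order_trans[OF abs_triangle_ineq]) (simp add: abs_mult)
        also have "\<dots> \<le> \<bar>f' x\<bar> * e + \<bar>g' x\<bar> * e"
          using x st tT by (intro add_mono mult_left_mono less_imp_le[OF d1(2)] less_imp_le[OF d2(2)]) auto
        finally show "\<bar>f' x * (g t - g x) + g' x * (f s - f x)\<bar> \<le> e * (\<bar>f' x\<bar> + \<bar>g' x\<bar>)"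
          by (simp add: algebra_simps)
      qed
      then show ?thesis by (simp add: algebra_simps)
    qed
    then show "\<exists>d>0. \<forall>s t. 0 \<le> s \<and> s \<le> t \<and> t \<le> t0 \<and> t - s < d \<longrightarrow>
       \<bar>D t - D s\<bar> \<le> e * ((F t + G t) - (F s + G s))"
      using d1(1) d2(1) by (intro exI[of _ "min d1 d2"]) auto
  qed
  then have "integral {0..t} ?h = f t * g t - f 0 * g 0" if "t \<in> {0..T}" for t
    using that by (fastforce simp: D_def)
  then have "(?h has_integral (f t * g t - f 0 * g 0)) {0..t}" if "t \<in> {0..T}" for t
    using that Hd by (fastforce simp: has_density_def)
  with h_abs show ?thesis by (auto simp: has_density_def)
qed

text \<open>As \<open>f'\<close> is nonnegative, f dominates its own variation and can serve as the
  dominating function. Together with \<open>f 0 = 0\<close> it also gives f >= 0, and there x |->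
  exp (- x) has Lipschitz constant 1.\<close>

lemma has_density_exp_minus:
  assumes f: "has_density T f f'" and nonneg: "\<And>t. t \<in> {0..T} \<Longrightarrow> f' t \<ge> 0" and f0: "f 0 = 0"
  shows "has_density T (\<lambda>t. exp (- f t)) (\<lambda>t. - f' t * exp (- f t))"
proof -
  let ?h = "\<lambda>t. - f' t * exp (- f t)"
  have cf: "continuous_on {0..T} f" using f has_density_continuous by auto
  have h_abs: "?h absolutely_integrable_on {0..T}"
  proof -
    have "continuous_on {0..T} (\<lambda>t. - exp (- f t))" by (intro continuous_intros cf)
    then show ?thesis
      using absolutely_integrable_continuous_mult[of 0 T "\<lambda>t. - exp (- f t)" f'] f
      by (simp add: has_density_def mult.commute)
  qed
  note Hd = has_density_indefinite_integral[OF h_abs]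
  have mono: "f s \<le> f t" if "0 \<le> s" "s \<le> t" "t \<le> T" for s t
    using has_integral_nonneg[OF has_density_integral[OF f that]] nonneg that by auto
  have pos: "0 \<le> f t" if "t \<in> {0..T}" for t
    using mono[of 0 t] f0 that by auto
  define D where "D t = exp (- f t) - integral {0..t} ?h" for t
  have "D t0 = D 0" if t0: "t0 \<in> {0..T}" for t0
  proof (rule constant_if_small_increments[where H=f])
    show "0 \<le> t0" using t0 by simp
    fix e :: real assume "e > 0"
    obtain d where d: "d > 0" "\<And>s t. s \<in> {0..T} \<Longrightarrow> t \<in> {0..T} \<Longrightarrow> \<bar>t - s\<bar> < d \<Longrightarrow> \<bar>f t - f s\<bar> < e"
      using uniform_oscillation[OF cf \<open>e > 0\<close>] by metis
    have "\<bar>D t - D s\<bar> \<le> e * (f t - f s)"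
      if st: "0 \<le> s" "s \<le> t" "t \<le> t0" "t - s < d" for s t
    proof -
      have tT: "t \<le> T" using st t0 by simp
      note h = has_density_integral[OF Hd st(1,2) tT]
      \<comment> \<open>A mean value point turns the increment of exp (- f) into the integral of -
        f' exp (- c), which can be compared pointwise with the claimed density. If f s = f t the
        mean value theorem has no interval to work on, and the common value serves.\<close>
      obtain c where c: "f s \<le> c" "c \<le> f t" "exp (- f t) - exp (- f s) = (f t - f s) * - exp (- c)"
      proof (cases "f s = f t")
        case True
        then show ?thesis using that[of "f s"] by simp
      next
        case False
        then have "f s < f t" using mono[OF st(1,2) tT] by simp
        moreover have "((\<lambda>x. exp (- x)) has_real_derivative - exp (- x)) (at x)" for x :: real
          by (auto intro!: derivative_eq_intros)
        ultimately obtain z where "f s < z" "z < f t"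
            "exp (- f t) - exp (- f s) = (f t - f s) * - exp (- z)"
          using MVT2[of "f s" "f t" "\<lambda>x. exp (- x)" "\<lambda>x. - exp (- x)"] by blast
        then show ?thesis using that[of z] by simp
      qed
      have K: "((\<lambda>x. f' x * - exp (- c)) has_integral ((f t - f s) * - exp (- c))) {s..t}"
        by (intro has_integral_mult_left has_density_integral[OF f] st tT)
      have eq: "(f t - f s) * - exp (- c) - (integral {0..t} ?h - integral {0..s} ?h) = D t - D s"
        using c(3) by (simp add: D_def)
      have "((\<lambda>x. f' x * - exp (- c) - ?h x) has_integral (D t - D s)) {s..t}"
        using has_integral_diff[OF K h] unfolding eq .
      then have I: "((\<lambda>x. f' x * (exp (- f x) - exp (- c))) has_integral (D t - D s)) {s..t}"
        by (simp add: algebra_simps)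
      have J: "((\<lambda>x. e * f' x) has_integral (e * (f t - f s))) {s..t}"
        by (intro has_integral_mult_right has_density_integral[OF f] st tT)
      have lip: "\<bar>exp (- a) - exp (- b)\<bar> \<le> \<bar>a - b\<bar>" if "0 \<le> a" "0 \<le> b" for a b :: real
      proof -
        have *: "exp (- a) - exp (- b) \<le> b - a" if "0 \<le> a" "a \<le> b" for a b :: real
        proof -
          have "exp (- b) = exp (- a) * exp (a - b)" by (simp add: exp_add[symmetric])
          moreover have "exp (- a) * (1 + (a - b)) \<le> exp (- a) * exp (a - b)"
            by (intro mult_left_mono) auto
          moreover have "exp (- a) * (b - a) \<le> 1 * (b - a)"
            using that by (intro mult_right_mono) auto
          ultimately show ?thesis by (simp add: algebra_simps)
        qed
        show ?thesis using *[of a b] *[of b a] that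
          by (cases "a \<le> b") (auto simp: abs_if)
      qed
      have "\<bar>D t - D s\<bar> \<le> e * (f t - f s)"
      proof (rule has_integral_abs_bound[OF I J])
        fix x assume x: "x \<in> {s..t}"
        have "f s \<le> f x" "f x \<le> f t" using mono x st tT by auto
        moreover have "0 \<le> f s" using pos[of s] st tT by auto
        ultimately have "\<bar>exp (- f x) - exp (- c)\<bar> \<le> f t - f s"
          using lip[of "f x" c] c by auto
        also have "\<dots> \<le> e" using d(2)[of s t] st tT by auto
        finally have "\<bar>f' x\<bar> * \<bar>exp (- f x) - exp (- c)\<bar> \<le> \<bar>f' x\<bar> * e"
          by (intro mult_left_mono) auto
        then show "\<bar>f' x * (exp (- f x) - exp (- c))\<bar> \<le> e * f' x"
          using nonneg[of x] x st tT by (simp add: abs_mult mult.commute)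
      qed
      then show ?thesis by simp
    qed
    then show "\<exists>d>0. \<forall>s t. 0 \<le> s \<and> s \<le> t \<and> t \<le> t0 \<and> t - s < d \<longrightarrow> \<bar>D t - D s\<bar> \<le> e * (f t - f s)"
      using d(1) by (intro exI[of _ d]) auto
  qed
  then have "integral {0..t} ?h = exp (- f t) - exp (- f 0)" if "t \<in> {0..T}" for t
    using that by (fastforce simp: D_def)
  then have "(?h has_integral (exp (- f t) - exp (- f 0))) {0..t}" if "t \<in> {0..T}" for t
    using that Hd by (fastforce simp: has_density_def)
  with h_abs show ?thesis by (auto simp: has_density_def)
qed

subsection \<open>Lyapunov operators\<close>


text \<open>Matrices are represented as functions restricted to an index set. The error system lives
  on a disjoint union of index sets, so its block matrices become functions defined by cases,
  without index shifts.\<close>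

definition bform :: "'i set \<Rightarrow> ('i \<Rightarrow> 'i \<Rightarrow> real) \<Rightarrow> ('i \<Rightarrow> real) \<Rightarrow> ('i \<Rightarrow> real) \<Rightarrow> real" where
  "bform I M v w = (\<Sum>i\<in>I. \<Sum>j\<in>I. v i * M i j * w j)"

definition mvec :: "'i set \<Rightarrow> ('i \<Rightarrow> 'i \<Rightarrow> real) \<Rightarrow> ('i \<Rightarrow> real) \<Rightarrow> 'i \<Rightarrow> real" where
  "mvec I M v i = (\<Sum>j\<in>I. M i j * v j)"

text \<open>Symmetry is not included. Cross terms are therefore symmetrised below, and symmetry is
  assumed separately where single entries have to be bounded.\<close>

definition psd :: "'i set \<Rightarrow> ('i \<Rightarrow> 'i \<Rightarrow> real) \<Rightarrow> bool" where
  "psd I M \<longleftrightarrow> (\<forall>v. 0 \<le> bform I M v v)"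

text \<open>Entry (i,j) of a P + P a^T + sum_k N_k P N_k^T.\<close>

definition lyap :: "'i set \<Rightarrow> nat \<Rightarrow> ('i \<Rightarrow> 'i \<Rightarrow> real) \<Rightarrow> (nat \<Rightarrow> 'i \<Rightarrow> 'i \<Rightarrow> real)
    \<Rightarrow> ('i \<Rightarrow> 'i \<Rightarrow> real) \<Rightarrow> 'i \<Rightarrow> 'i \<Rightarrow> real" where
  "lyap I m a N P i j = (\<Sum>l\<in>I. a i l * P l j) + (\<Sum>l\<in>I. P i l * a j l)
     + (\<Sum>k<m. \<Sum>l\<in>I. \<Sum>q\<in>I. N k i l * P l q * N k j q)"

text \<open>Entry (i,j) of a^T Y + Y a + sum_k N_k^T Y N_k.\<close>

definition adj_lyap :: "'i set \<Rightarrow> nat \<Rightarrow> ('i \<Rightarrow> 'i \<Rightarrow> real) \<Rightarrow> (nat \<Rightarrow> 'i \<Rightarrow> 'i \<Rightarrow> real)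
    \<Rightarrow> ('i \<Rightarrow> 'i \<Rightarrow> real) \<Rightarrow> 'i \<Rightarrow> 'i \<Rightarrow> real" where
  "adj_lyap I m a N Y i j = (\<Sum>l\<in>I. a l i * Y l j) + (\<Sum>l\<in>I. Y i l * a l j)
     + (\<Sum>k<m. \<Sum>l\<in>I. \<Sum>q\<in>I. N k l i * Y l q * N k q j)"

definition lyap_flow :: "'i set \<Rightarrow> nat \<Rightarrow> ('i \<Rightarrow> 'i \<Rightarrow> real) \<Rightarrow> (nat \<Rightarrow> 'i \<Rightarrow> 'i \<Rightarrow> real)
    \<Rightarrow> (real \<Rightarrow> 'i \<Rightarrow> 'i \<Rightarrow> real) \<Rightarrow> bool" where
  "lyap_flow I m a N Y \<longleftrightarrow> (\<forall>t. \<forall>i\<in>I. \<forall>j\<in>I.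
     ((\<lambda>s. Y s i j) has_real_derivative adj_lyap I m a N (Y t) i j) (at t))"

lemma sum_swap_pairs:
  "(\<Sum>i\<in>A. \<Sum>j\<in>B. \<Sum>l\<in>C. \<Sum>q\<in>D. f i j l q) = (\<Sum>l\<in>C. \<Sum>q\<in>D. \<Sum>i\<in>A. \<Sum>j\<in>B. f i j l q)"
proof -
  have "(\<Sum>i\<in>A. \<Sum>j\<in>B. \<Sum>l\<in>C. \<Sum>q\<in>D. f i j l q) = (\<Sum>i\<in>A. \<Sum>l\<in>C. \<Sum>j\<in>B. \<Sum>q\<in>D. f i j l q)"
    by (rule sum.cong[OF refl], rule sum.swap)
  also have "\<dots> = (\<Sum>l\<in>C. \<Sum>i\<in>A. \<Sum>j\<in>B. \<Sum>q\<in>D. f i j l q)" by (rule sum.swap)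
  also have "\<dots> = (\<Sum>l\<in>C. \<Sum>i\<in>A. \<Sum>q\<in>D. \<Sum>j\<in>B. f i j l q)"
    by (rule sum.cong[OF refl], rule sum.cong[OF refl], rule sum.swap)
  also have "\<dots> = (\<Sum>l\<in>C. \<Sum>q\<in>D. \<Sum>i\<in>A. \<Sum>j\<in>B. f i j l q)"
    by (rule sum.cong[OF refl], rule sum.swap)
  finally show ?thesis .
qed

lemma bform_congruence:
  "bform I (\<lambda>i j. \<Sum>l\<in>I. \<Sum>q\<in>I. M l i * Y l q * M' q j) v w = bform I Y (mvec I M v) (mvec I M' w)"
proof -
  have "bform I (\<lambda>i j. \<Sum>l\<in>I. \<Sum>q\<in>I. M l i * Y l q * M' q j) v w
      = (\<Sum>i\<in>I. \<Sum>j\<in>I. \<Sum>l\<in>I. \<Sum>q\<in>I. (M l i * v i) * Y l q * (M' q j * w j))"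
    by (simp add: bform_def sum_distrib_left sum_distrib_right mult_ac)
  also have "\<dots> = (\<Sum>l\<in>I. \<Sum>q\<in>I. \<Sum>i\<in>I. \<Sum>j\<in>I. (M l i * v i) * Y l q * (M' q j * w j))"
    by (rule sum_swap_pairs)
  also have "\<dots> = bform I Y (mvec I M v) (mvec I M' w)"
    by (simp add: bform_def mvec_def sum_distrib_left sum_distrib_right mult_ac)
  finally show ?thesis .
qed

lemma bform_mult_left: "bform I (\<lambda>i j. \<Sum>l\<in>I. M l i * Y l j) v w = bform I Y (mvec I M v) w"
proof -
  have "bform I (\<lambda>i j. \<Sum>l\<in>I. M l i * Y l j) v w = (\<Sum>i\<in>I. \<Sum>j\<in>I. \<Sum>l\<in>I. (M l i * v i) * Y l j * w j)"
    by (simp add: bform_def sum_distrib_left sum_distrib_right mult_ac)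
  also have "\<dots> = (\<Sum>i\<in>I. \<Sum>l\<in>I. \<Sum>j\<in>I. (M l i * v i) * Y l j * w j)"
    by (rule sum.cong[OF refl], rule sum.swap)
  also have "\<dots> = (\<Sum>l\<in>I. \<Sum>i\<in>I. \<Sum>j\<in>I. (M l i * v i) * Y l j * w j)"
    by (rule sum.swap)
  also have "\<dots> = (\<Sum>l\<in>I. \<Sum>j\<in>I. \<Sum>i\<in>I. (M l i * v i) * Y l j * w j)"
    by (rule sum.cong[OF refl], rule sum.swap)
  also have "\<dots> = bform I Y (mvec I M v) w"
    by (simp add: bform_def mvec_def sum_distrib_right)
  finally show ?thesis .
qed

lemma bform_transpose: "bform I (\<lambda>i j. M j i) v w = bform I M w v"
  unfolding bform_def by (subst sum.swap) (simp add: mult_ac)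

lemma bform_mult_right: "bform I (\<lambda>i j. \<Sum>l\<in>I. Y i l * M l j) v w = bform I Y v (mvec I M w)"
proof -
  have "bform I (\<lambda>i j. \<Sum>l\<in>I. Y i l * M l j) v w = bform I (\<lambda>i j. \<Sum>l\<in>I. M l i * Y j l) w v"
    unfolding bform_transpose[of I "\<lambda>i j. \<Sum>l\<in>I. Y i l * M l j" w v, symmetric] by (simp add: mult.commute)
  also have "\<dots> = bform I Y v (mvec I M w)"
    unfolding bform_mult_left[of I M "\<lambda>i j. Y j i"] by (rule bform_transpose)
  finally show ?thesis .
qed

lemma bform_add: "bform I (\<lambda>i j. M i j + M' i j) v w = bform I M v w + bform I M' v w"
  by (simp add: bform_def algebra_simps sum.distrib)

lemma bform_sum: "bform I (\<lambda>i j. \<Sum>k\<in>K. M k i j) v w = (\<Sum>k\<in>K. bform I (M k) v w)"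
proof (cases "finite K")
  case True
  then show ?thesis by induction (simp_all add: bform_add, simp add: bform_def)
qed (simp add: bform_def)

text \<open>In this shape the two drift terms visibly cancel, both along phi' = - a phi with Y
  running forward and along a trajectory with Y running backward in time. What remains are the
  \<open>N k\<close> terms.\<close>

lemma bform_adj_lyap:
  "bform I (adj_lyap I m a N Y) v w = bform I Y (mvec I a v) w + bform I Y v (mvec I a w)
     + (\<Sum>k<m. bform I Y (mvec I (N k) v) (mvec I (N k) w))"
  unfolding adj_lyap_def[abs_def]
  unfolding bform_add bform_sum[of I _ "{..<m}"] bform_congruence
    bform_mult_left[of I a Y] bform_mult_right[of I Y a] ..

text \<open>The duality between the two operators for the pairing tr (P^T Y). It is a pure exchange
  of summations, so neither matrix has to be symmetric.\<close>

lemma sum_mult_adj_lyap: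
  "(\<Sum>i\<in>I. \<Sum>j\<in>I. P i j * adj_lyap I m a N Y i j) = (\<Sum>i\<in>I. \<Sum>j\<in>I. lyap I m a N P i j * Y i j)"
proof -
  have 1: "(\<Sum>i\<in>I. \<Sum>j\<in>I. P i j * (\<Sum>l\<in>I. a l i * Y l j)) = (\<Sum>i\<in>I. \<Sum>j\<in>I. (\<Sum>l\<in>I. a i l * P l j) * Y i j)"
  proof -
    have "(\<Sum>i\<in>I. \<Sum>j\<in>I. P i j * (\<Sum>l\<in>I. a l i * Y l j)) = (\<Sum>i\<in>I. \<Sum>j\<in>I. \<Sum>l\<in>I. a l i * P i j * Y l j)"
      by (simp add: sum_distrib_left mult_ac)
    also have "\<dots> = (\<Sum>j\<in>I. \<Sum>i\<in>I. \<Sum>l\<in>I. a l i * P i j * Y l j)" by (rule sum.swap)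
    also have "\<dots> = (\<Sum>j\<in>I. \<Sum>l\<in>I. \<Sum>i\<in>I. a l i * P i j * Y l j)"
      by (rule sum.cong[OF refl], rule sum.swap)
    also have "\<dots> = (\<Sum>l\<in>I. \<Sum>j\<in>I. \<Sum>i\<in>I. a l i * P i j * Y l j)" by (rule sum.swap)
    finally show ?thesis by (simp add: sum_distrib_right)
  qed
  have 2: "(\<Sum>i\<in>I. \<Sum>j\<in>I. P i j * (\<Sum>l\<in>I. Y i l * a l j)) = (\<Sum>i\<in>I. \<Sum>j\<in>I. (\<Sum>l\<in>I. P i l * a j l) * Y i j)"
  proof -
    have "(\<Sum>i\<in>I. \<Sum>j\<in>I. P i j * (\<Sum>l\<in>I. Y i l * a l j)) = (\<Sum>i\<in>I. \<Sum>j\<in>I. \<Sum>l\<in>I. P i j * a l j * Y i l)"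
      by (simp add: sum_distrib_left mult_ac)
    also have "\<dots> = (\<Sum>i\<in>I. \<Sum>l\<in>I. \<Sum>j\<in>I. P i j * a l j * Y i l)"
      by (rule sum.cong[OF refl], rule sum.swap)
    finally show ?thesis by (simp add: sum_distrib_right)
  qed
  have 3: "(\<Sum>i\<in>I. \<Sum>j\<in>I. P i j * (\<Sum>l\<in>I. \<Sum>q\<in>I. N k l i * Y l q * N k q j))
      = (\<Sum>i\<in>I. \<Sum>j\<in>I. (\<Sum>l\<in>I. \<Sum>q\<in>I. N k i l * P l q * N k j q) * Y i j)" for k
  proof -
    have "(\<Sum>i\<in>I. \<Sum>j\<in>I. P i j * (\<Sum>l\<in>I. \<Sum>q\<in>I. N k l i * Y l q * N k q j))
      = (\<Sum>i\<in>I. \<Sum>j\<in>I. \<Sum>l\<in>I. \<Sum>q\<in>I. N k l i * P i j * N k q j * Y l q)"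
      by (simp add: sum_distrib_left mult_ac)
    also have "\<dots> = (\<Sum>l\<in>I. \<Sum>q\<in>I. \<Sum>i\<in>I. \<Sum>j\<in>I. N k l i * P i j * N k q j * Y l q)"
      by (rule sum_swap_pairs)
    finally show ?thesis by (simp add: sum_distrib_right)
  qed
  have pull: "(\<Sum>i\<in>I. \<Sum>j\<in>I. \<Sum>k<m. F i j k) = (\<Sum>k<m. \<Sum>i\<in>I. \<Sum>j\<in>I. F i j k)"
    for F :: "'a \<Rightarrow> 'a \<Rightarrow> nat \<Rightarrow> real"
  proof -
    have "(\<Sum>i\<in>I. \<Sum>j\<in>I. \<Sum>k<m. F i j k) = (\<Sum>i\<in>I. \<Sum>k<m. \<Sum>j\<in>I. F i j k)"
      by (rule sum.cong[OF refl], rule sum.swap)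
    also have "\<dots> = (\<Sum>k<m. \<Sum>i\<in>I. \<Sum>j\<in>I. F i j k)" by (rule sum.swap)
    finally show ?thesis .
  qed
  have "(\<Sum>i\<in>I. \<Sum>j\<in>I. P i j * adj_lyap I m a N Y i j) =
     (\<Sum>i\<in>I. \<Sum>j\<in>I. P i j * (\<Sum>l\<in>I. a l i * Y l j)) + (\<Sum>i\<in>I. \<Sum>j\<in>I. P i j * (\<Sum>l\<in>I. Y i l * a l j))
      + (\<Sum>k<m. \<Sum>i\<in>I. \<Sum>j\<in>I. P i j * (\<Sum>l\<in>I. \<Sum>q\<in>I. N k l i * Y l q * N k q j))"
    unfolding pull[of "\<lambda>i j k. P i j * (\<Sum>l\<in>I. \<Sum>q\<in>I. N k l i * Y l q * N k q j)", symmetric]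
    by (simp only: adj_lyap_def distrib_left sum.distrib sum_distrib_left[of _ _ "{..<m}"])
  also have "\<dots> = (\<Sum>i\<in>I. \<Sum>j\<in>I. lyap I m a N P i j * Y i j)"
    unfolding 1 2 3 pull[of "\<lambda>i j k. (\<Sum>l\<in>I. \<Sum>q\<in>I. N k i l * P l q * N k j q) * Y i j", symmetric]
    by (simp only: lyap_def distrib_right sum.distrib sum_distrib_right[of _ "{..<m}"])
  finally show ?thesis .
qed

lemma lyap_flow_exists:
  assumes fin: "finite I"
  shows "\<exists>Y. lyap_flow I m a N Y \<and> (\<forall>i j. Y 0 i j = Y0 i j)"
proof -
  \<comment> \<open>The adjoint operator written as a matrix acting on entries indexed by pairs,
    that is, its Kronecker form; the matrix equation thereby becomes an ordinary linear system on
    \<open>I \<times> I\<close>.\<close>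
  define l where "l = (\<lambda>(i,j) (p,q). (if q = j then a p i else 0) + (if p = i then a q j else 0)
      + (\<Sum>k<m. N k p i * N k q j))"
  obtain y where y0: "\<And>j. y 0 j = (\<lambda>(i,j). Y0 i j) j"
    and y: "\<And>t j. j \<in> I \<times> I \<Longrightarrow> ((\<lambda>s. y s j) has_real_derivative (\<Sum>q\<in>I\<times>I. l j q * y t q)) (at t)"
    using linear_ode_solution_exists[of "I \<times> I" "\<lambda>(i,j). Y0 i j" l] fin by blast
  define Y where "Y t i j = y t (i,j)" for t i j
  have "(\<Sum>q\<in>I\<times>I. l (i,j) q * y t q) = adj_lyap I m a N (Y t) i j" if "i \<in> I" "j \<in> I" for i j t
  proof -
    have "(\<Sum>q\<in>I\<times>I. l (i,j) q * y t q) = (\<Sum>p\<in>I. \<Sum>q\<in>I. l (i,j) (p,q) * Y t p q)"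
      by (simp add: sum.cartesian_product Y_def split_def)
    also have "\<dots> = (\<Sum>p\<in>I. \<Sum>q\<in>I. (if q = j then a p i * Y t p q else 0))
        + (\<Sum>p\<in>I. \<Sum>q\<in>I. (if p = i then a q j * Y t p q else 0))
        + (\<Sum>p\<in>I. \<Sum>q\<in>I. \<Sum>k<m. N k p i * Y t p q * N k q j)"
      unfolding sum.distrib[symmetric]
      by (intro sum.cong refl) (simp add: l_def algebra_simps sum_distrib_left)
    also have "(\<Sum>p\<in>I. \<Sum>q\<in>I. (if q = j then a p i * Y t p q else 0)) = (\<Sum>p\<in>I. a p i * Y t p j)"
      using that fin by (simp add: sum.delta)
    also have "(\<Sum>p\<in>I. \<Sum>q\<in>I. (if p = i then a q j * Y t p q else 0)) = (\<Sum>q\<in>I. Y t i q * a q j)"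
      by (subst sum.swap) (use that fin in \<open>simp add: sum.delta mult.commute\<close>)
    also have "(\<Sum>p\<in>I. \<Sum>q\<in>I. \<Sum>k<m. N k p i * Y t p q * N k q j)
        = (\<Sum>p\<in>I. \<Sum>k<m. \<Sum>q\<in>I. N k p i * Y t p q * N k q j)"
      by (rule sum.cong[OF refl], rule sum.swap)
    also have "\<dots> = (\<Sum>k<m. \<Sum>p\<in>I. \<Sum>q\<in>I. N k p i * Y t p q * N k q j)" by (rule sum.swap)
    finally show ?thesis by (simp add: adj_lyap_def)
  qed
  with y have "lyap_flow I m a N Y" by (auto simp: lyap_flow_def Y_def)
  with y0 show ?thesis by (intro exI[of _ Y]) (auto simp: Y_def)
qed

lemma adj_lyap_transpose: "adj_lyap I m a N (\<lambda>i j. Y j i) i j = adj_lyap I m a N Y j i"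
proof -
  have "(\<Sum>l\<in>I. \<Sum>q\<in>I. N k l i * Y q l * N k q j) = (\<Sum>l\<in>I. \<Sum>q\<in>I. N k l j * Y l q * N k q i)" for k
    by (subst sum.swap) (simp add: mult_ac)
  then show ?thesis by (simp add: adj_lyap_def mult.commute)
qed

lemma adj_lyap_linear:
  "adj_lyap I m a N (\<lambda>i j. c * X i j + d * Y i j) i j = c * adj_lyap I m a N X i j + d * adj_lyap I m a N Y i j"
  by (simp add: adj_lyap_def distrib_left distrib_right sum.distrib sum_distrib_left mult_ac)

lemma lyap_flow_linear:
  assumes "lyap_flow I m a N X" "lyap_flow I m a N Y"
  shows "lyap_flow I m a N (\<lambda>t i j. c * X t i j + d * Y t i j)"
  using assms unfolding lyap_flow_def adj_lyap_linear
  by (intro allI ballI DERIV_add DERIV_cmult) auto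

lemma lyap_flow_transpose:
  assumes "lyap_flow I m a N Y"
  shows "lyap_flow I m a N (\<lambda>t i j. Y t j i)"
  using assms adj_lyap_transpose[of I m a N "Y t" for t] by (simp add: lyap_flow_def)

text \<open>A linear equation with constant coefficients is also solved by the derivative of a
  solution. This lets positivity be applied to the derivative of a flow and shows that this
  derivative is continuous.\<close>

lemma lyap_flow_generator:
  assumes "lyap_flow I m a N Y"
  shows "lyap_flow I m a N (\<lambda>t. adj_lyap I m a N (Y t))"
  unfolding lyap_flow_def
proof (intro allI ballI)
  fix t i j assume ij: "i \<in> I" "j \<in> I"
  define Z where "Z = adj_lyap I m a N (Y t)"
  have Y: "((\<lambda>s. Y s p q) has_real_derivative Z p q) (at t)" if "p \<in> I" "q \<in> I" for p q
    using assms that by (auto simp: lyap_flow_def Z_def)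
  show "((\<lambda>s. adj_lyap I m a N (Y s) i j) has_real_derivative
      adj_lyap I m a N (adj_lyap I m a N (Y t)) i j) (at t)"
    unfolding adj_lyap_def[of I m a N "Y s" for s] Z_def[symmetric] adj_lyap_def[of I m a N Z]
    using ij by (intro DERIV_add DERIV_sum DERIV_cmult DERIV_cmult_right Y) auto
qed

text \<open>The operator commutes with transposition, so the average of a solution and its transpose
  is again a solution; uniqueness of solutions does not have to be invoked.\<close>

lemma symmetric_lyap_flow_exists:
  assumes "finite I" "\<And>i j. Y0 i j = Y0 j i"
  shows "\<exists>Y. lyap_flow I m a N Y \<and> (\<forall>i j. Y 0 i j = Y0 i j) \<and> (\<forall>t i j. Y t i j = Y t j i)"
proof -
  obtain Y where Y: "lyap_flow I m a N Y" "\<And>i j. Y 0 i j = Y0 i j"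
    using lyap_flow_exists[OF assms(1)] by metis
  have "lyap_flow I m a N (\<lambda>t i j. 1/2 * Y t i j + 1/2 * Y t j i)"
    using lyap_flow_linear[OF Y(1) lyap_flow_transpose[OF Y(1)]] .
  then show ?thesis
    using Y(2) assms(2) by (intro exI[of _ "\<lambda>t i j. 1/2 * Y t i j + 1/2 * Y t j i"]) (auto simp: add.commute)
qed

subsection \<open>Positivity of the Lyapunov flow\<close>


lemma bform_linear: "bform I (\<lambda>i j. c * X i j + d * Y i j) v w = c * bform I X v w + d * bform I Y v w"
  by (simp add: bform_def distrib_left distrib_right sum.distrib sum_distrib_left mult_ac)

lemma bform_cong:
  assumes "\<And>i j. i \<in> I \<Longrightarrow> j \<in> I \<Longrightarrow> M i j = M' i j"
  shows "bform I M v w = bform I M' v w"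
  using assms by (auto simp: bform_def intro!: sum.cong)

lemma bform_add_vec:
  "bform I M (\<lambda>i. v i + c * w i) (\<lambda>i. v i + c * w i) =
     bform I M v v + c * (bform I M v w + bform I M w v) + c\<^sup>2 * bform I M w w"
  by (simp add: bform_def distrib_left distrib_right sum.distrib sum_distrib_left power2_eq_square mult_ac)

lemma bform_unit:
  assumes "finite I" "i \<in> I" "j \<in> I"
  shows "bform I M (\<lambda>l. if l = i then 1 else 0) (\<lambda>l. if l = j then 1 else 0) = M i j"
proof -
  have "bform I M (\<lambda>l. if l = i then 1 else 0) (\<lambda>l. if l = j then 1 else 0)
      = (\<Sum>p\<in>I. \<Sum>q\<in>I. if q = j then (if p = i then M p q else 0) else 0)"
    unfolding bform_def by (intro sum.cong refl) auto
  also have "\<dots> = M i j" using assms by (simp add: sum.delta)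
  finally show ?thesis .
qed

lemma bform_has_derivative:
  assumes Y: "\<And>i j. i \<in> I \<Longrightarrow> j \<in> I \<Longrightarrow> ((\<lambda>s. Y s i j) has_real_derivative Y' i j) (at t)"
    and v: "\<And>i. i \<in> I \<Longrightarrow> ((\<lambda>s. v s i) has_real_derivative v' i) (at t)"
  shows "((\<lambda>s. bform I (Y s) (v s) (v s)) has_real_derivative
     (bform I (Y t) v' (v t) + bform I Y' (v t) (v t) + bform I (Y t) (v t) v')) (at t)"
proof -
  have "((\<lambda>s. bform I (Y s) (v s) (v s)) has_real_derivative (\<Sum>i\<in>I. \<Sum>j\<in>I.
      v' i * Y t i j * v t j + v t i * Y' i j * v t j + v t i * Y t i j * v' j)) (at t)"
    unfolding bform_def
  proof (intro DERIV_sum)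
    fix i j assume "i \<in> I" "j \<in> I"
    show "((\<lambda>s. v s i * Y s i j * v s j) has_real_derivative
        v' i * Y t i j * v t j + v t i * Y' i j * v t j + v t i * Y t i j * v' j) (at t)"
      by (rule DERIV_cong[OF DERIV_mult[OF DERIV_mult[OF v[OF \<open>i \<in> I\<close>] Y[OF \<open>i \<in> I\<close> \<open>j \<in> I\<close>]] v[OF \<open>j \<in> I\<close>]]])
        (simp add: algebra_simps)
  qed
  then show ?thesis by (simp add: bform_def sum.distrib)
qed

lemma bform_bound:
  assumes "\<And>i j. i \<in> I \<Longrightarrow> j \<in> I \<Longrightarrow> \<bar>M i j\<bar> \<le> \<kappa>" "\<kappa> \<ge> 0"
  shows "\<bar>bform I M v v\<bar> \<le> \<kappa> * card I * (\<Sum>i\<in>I. (v i)\<^sup>2)"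
proof -
  have "\<bar>bform I M v v\<bar> \<le> (\<Sum>i\<in>I. \<Sum>j\<in>I. \<bar>v i * M i j * v j\<bar>)"
    unfolding bform_def by (intro order_trans[OF sum_abs] sum_mono order_refl)
  also have "\<dots> \<le> (\<Sum>i\<in>I. \<Sum>j\<in>I. \<kappa> / 2 * ((v i)\<^sup>2 + (v j)\<^sup>2))"
  proof (intro sum_mono)
    fix i j assume "i \<in> I" "j \<in> I"
    have "\<bar>v i * M i j * v j\<bar> = \<bar>M i j\<bar> * \<bar>v i * v j\<bar>" by (simp add: abs_mult)
    also have "\<dots> \<le> \<kappa> * (((v i)\<^sup>2 + (v j)\<^sup>2) / 2)"
    proof (intro mult_mono)
      have "2 * \<bar>v i * v j\<bar> \<le> (v i)\<^sup>2 + (v j)\<^sup>2"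
        using sum_squares_bound[of "\<bar>v i\<bar>" "\<bar>v j\<bar>"] by (simp add: abs_mult)
      then show "\<bar>v i * v j\<bar> \<le> ((v i)\<^sup>2 + (v j)\<^sup>2) / 2" by simp
    qed (use assms \<open>i \<in> I\<close> \<open>j \<in> I\<close> in auto)
    finally show "\<bar>v i * M i j * v j\<bar> \<le> \<kappa> / 2 * ((v i)\<^sup>2 + (v j)\<^sup>2)" by simp
  qed
  also have "\<dots> = \<kappa> / 2 * ((\<Sum>i\<in>I. \<Sum>j\<in>I. (v i)\<^sup>2) + (\<Sum>i\<in>I. \<Sum>j\<in>I. (v j)\<^sup>2))"
    by (simp only: sum.distrib[symmetric] sum_distrib_left)
  also have "\<dots> = \<kappa> * card I * (\<Sum>i\<in>I. (v i)\<^sup>2)"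
    by (simp add: sum_distrib_left mult_ac)
  finally show ?thesis .
qed

lemma bform_bound_exists:
  assumes "finite I"
  shows "\<exists>K\<ge>0. \<forall>v. \<bar>bform I M v v\<bar> \<le> K * (\<Sum>i\<in>I. (v i)\<^sup>2)"
proof -
  define \<kappa> where "\<kappa> = (\<Sum>i\<in>I. \<Sum>j\<in>I. \<bar>M i j\<bar>)"
  have "\<bar>M i j\<bar> \<le> \<kappa>" if "i \<in> I" "j \<in> I" for i j
  proof -
    have "\<bar>M i j\<bar> \<le> (\<Sum>j\<in>I. \<bar>M i j\<bar>)" using that assms by (intro member_le_sum) auto
    also have "\<dots> \<le> \<kappa>" unfolding \<kappa>_def using that assms
      by (intro member_le_sum[of i I "\<lambda>i. \<Sum>j\<in>I. \<bar>M i j\<bar>"]) (auto intro!: sum_nonneg)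
    finally show ?thesis .
  qed
  moreover have "\<kappa> \<ge> 0" by (auto simp: \<kappa>_def intro!: sum_nonneg)
  ultimately show ?thesis
    using bform_bound[of I M \<kappa>] by (intro exI[of _ "\<kappa> * card I"]) auto
qed

lemma mvec_square_bound_exists:
  assumes "finite I"
  shows "\<exists>K\<ge>0. \<forall>v. (\<Sum>k<m. \<Sum>i\<in>I. (mvec I (N k) v i)\<^sup>2) \<le> K * (\<Sum>i\<in>I. (v i)\<^sup>2)"
proof -
  let ?d = "\<lambda>l q. if l = q then 1 else 0 :: real"
  \<comment> \<open>With \<open>?d\<close> the identity, \<open>Q\<close> is the matrix sum_k N_k^T
    N_k, whose quadratic form is the sum in question.\<close>
  define Q where "Q = (\<lambda>i j. \<Sum>k<m. \<Sum>l\<in>I. \<Sum>q\<in>I. N k l i * ?d l q * N k q j)"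
  obtain K where K: "K \<ge> 0" "\<And>v. \<bar>bform I Q v v\<bar> \<le> K * (\<Sum>i\<in>I. (v i)\<^sup>2)"
    using bform_bound_exists[OF assms, of Q] by blast
  have "(\<Sum>i\<in>I. (w i)\<^sup>2) = bform I ?d w w" for w
  proof -
    have "bform I ?d w w = (\<Sum>i\<in>I. \<Sum>j\<in>I. if i = j then w i * w j else 0)"
      unfolding bform_def by (intro sum.cong refl) auto
    also have "\<dots> = (\<Sum>i\<in>I. (w i)\<^sup>2)"
      using assms by (simp add: power2_eq_square)
    finally show ?thesis by simp
  qed
  then have "(\<Sum>k<m. \<Sum>i\<in>I. (mvec I (N k) v i)\<^sup>2)
      = bform I Q v v" for v
    unfolding Q_def bform_sum[of I _ "{..<m}"] bform_congruence by simp
  then show ?thesis using K abs_le_D1[OF K(2)] by (intro exI[of _ K]) simp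
qed

text \<open>The derivative of |phi|^2 is - 2 phi^T a phi >= - 2 K |phi|^2, so |phi(s)|^2 exp (2 K s)
  is nondecreasing. Prescribing the value at the right end t thus bounds the whole past by M = exp
  (2 K T), uniformly in t and v, as the iteration over all vectors in the positivity proof
  requires.\<close>

lemma backward_flow_exists:
  assumes fin: "finite I" and T: "T \<ge> 0"
  shows "\<exists>M\<ge>0. \<forall>t\<in>{0..T}. \<forall>v. \<exists>\<phi>. \<phi> t = v \<and>
    (\<forall>s. \<forall>i\<in>I. ((\<lambda>s. \<phi> s i) has_real_derivative - mvec I a (\<phi> s) i) (at s)) \<and>
    (\<forall>s\<in>{0..t}. (\<Sum>i\<in>I. (\<phi> s i)\<^sup>2) \<le> M * (\<Sum>i\<in>I. (v i)\<^sup>2))"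
proof -
  obtain K where K: "K \<ge> 0" "\<And>v. \<bar>bform I a v v\<bar> \<le> K * (\<Sum>i\<in>I. (v i)\<^sup>2)"
    using bform_bound_exists[OF fin, of a] by blast
  have "\<exists>\<phi>. \<phi> t = v \<and>
    (\<forall>s. \<forall>i\<in>I. ((\<lambda>s. \<phi> s i) has_real_derivative - mvec I a (\<phi> s) i) (at s)) \<and>
    (\<forall>s\<in>{0..t}. (\<Sum>i\<in>I. (\<phi> s i)\<^sup>2) \<le> exp (2 * K * T) * (\<Sum>i\<in>I. (v i)\<^sup>2))"
    if t: "t \<in> {0..T}" for t v
  proof -
    obtain y where y0: "\<And>j. y 0 j = v j"
      and y: "\<And>t j. j \<in> I \<Longrightarrow> ((\<lambda>s. y s j) has_real_derivative (\<Sum>q\<in>I. - a j q * y t q)) (at t)"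
      using linear_ode_solution_exists[OF fin, of v "\<lambda>j q. - a j q"] by blast
    define \<phi> where "\<phi> s = y (s - t)" for s
    have \<phi>: "((\<lambda>s. \<phi> s i) has_real_derivative - mvec I a (\<phi> s) i) (at s)" if "i \<in> I" for s i
    proof -
      have "((\<lambda>s. s - t) has_real_derivative 1) (at s)" by (auto intro!: derivative_eq_intros)
      from DERIV_chain2[OF y[OF that] this] show ?thesis
        by (simp add: \<phi>_def mvec_def sum_negf)
    qed
    define n where "n s = (\<Sum>i\<in>I. (\<phi> s i)\<^sup>2)" for s
    have n: "(n has_real_derivative - 2 * bform I a (\<phi> s) (\<phi> s)) (at s)" for s
    proof -
      have "(n has_real_derivative (\<Sum>i\<in>I. 2 * \<phi> s i * - mvec I a (\<phi> s) i)) (at s)"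
        unfolding n_def power2_eq_square
      proof (intro DERIV_sum)
        fix i assume i: "i \<in> I"
        show "((\<lambda>s. \<phi> s i * \<phi> s i) has_real_derivative 2 * \<phi> s i * - mvec I a (\<phi> s) i) (at s)"
          by (rule DERIV_cong[OF DERIV_mult[OF \<phi>[OF i] \<phi>[OF i]]]) simp
      qed
      also have "(\<Sum>i\<in>I. 2 * \<phi> s i * - mvec I a (\<phi> s) i) = - 2 * bform I a (\<phi> s) (\<phi> s)"
        by (simp add: bform_def mvec_def sum_distrib_left sum_negf mult_ac)
      finally show ?thesis .
    qed
    have "n s \<le> exp (2 * K * T) * (\<Sum>i\<in>I. (v i)\<^sup>2)" if s: "s \<in> {0..t}" for s
    proof -
      have "n s * exp (2 * K * s) \<le> n t * exp (2 * K * t)"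
      proof (rule DERIV_nonneg_imp_nondecreasing[where f="\<lambda>s. n s * exp (2 * K * s)"])
        show "s \<le> t" using s by simp
        fix x
        have "((\<lambda>s. exp (2 * K * s)) has_real_derivative 2 * K * exp (2 * K * x)) (at x)"
          by (auto intro!: derivative_eq_intros)
        from DERIV_mult[OF n[of x] this]
        have "((\<lambda>s. n s * exp (2 * K * s)) has_real_derivative
            2 * exp (2 * K * x) * (K * n x - bform I a (\<phi> x) (\<phi> x))) (at x)"
          by (rule DERIV_cong) (simp add: algebra_simps)
        moreover have "0 \<le> 2 * exp (2 * K * x) * (K * n x - bform I a (\<phi> x) (\<phi> x))"
          using K(2)[of "\<phi> x"] by (auto simp: n_def)
        ultimately show "\<exists>y. ((\<lambda>s. n s * exp (2 * K * s)) has_real_derivative y) (at x) \<and> 0 \<le> y"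
          by blast
      qed
      moreover have "exp (2 * K * s) \<ge> 1" using K(1) s by auto
      moreover have n0: "n u \<ge> 0" for u by (auto simp: n_def intro!: sum_nonneg)
      moreover have "exp (2 * K * t) \<le> exp (2 * K * T)"
        using K(1) t by (auto intro!: mult_left_mono)
      ultimately have "n s * 1 \<le> n t * exp (2 * K * T)"
        by (meson mult_left_mono order_trans)
      moreover have "n t = (\<Sum>i\<in>I. (v i)\<^sup>2)" by (simp add: n_def \<phi>_def y0)
      ultimately show ?thesis by (simp add: mult.commute)
    qed
    moreover have "\<phi> t = v" using y0 by (auto simp: \<phi>_def)
    ultimately show ?thesis using \<phi> by (intro exI[of _ \<phi>]) (auto simp: n_def)
  qed
  then show ?thesis by (intro exI[of _ "exp (2 * K * T)"]) auto
qed

lemma lyap_flow_bounded: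
  assumes fin: "finite I" and Y: "lyap_flow I m a N Y"
  shows "\<exists>K\<ge>0. \<forall>t\<in>{0..T}. \<forall>v. \<bar>bform I (Y t) v v\<bar> \<le> K * (\<Sum>i\<in>I. (v i)\<^sup>2)"
proof -
  define S where "S s = (\<Sum>i\<in>I. \<Sum>j\<in>I. \<bar>Y s i j\<bar>)" for s
  have "continuous_on {0..T} (\<lambda>s. Y s i j)" if "i \<in> I" "j \<in> I" for i j
    using Y that unfolding lyap_flow_def
    by (intro continuous_at_imp_continuous_on ballI) (blast intro: DERIV_isCont)
  then have "continuous_on {0..T} S"
    unfolding S_def by (intro continuous_intros) auto
  then have "bounded (S ` {0..T})" by (intro compact_imp_bounded compact_continuous_image) auto
  then obtain \<kappa> where \<kappa>: "\<And>s. s \<in> {0..T} \<Longrightarrow> \<bar>S s\<bar> \<le> \<kappa>" "\<kappa> > 0"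
    unfolding bounded_pos by (auto simp del: atLeastAtMost_iff)
  have "\<bar>Y s i j\<bar> \<le> \<kappa>" if "i \<in> I" "j \<in> I" "s \<in> {0..T}" for i j s
  proof -
    have "\<bar>Y s i j\<bar> \<le> (\<Sum>j\<in>I. \<bar>Y s i j\<bar>)" using that fin by (intro member_le_sum) auto
    also have "\<dots> \<le> S s" unfolding S_def using that fin
      by (intro member_le_sum[of i I "\<lambda>i. \<Sum>j\<in>I. \<bar>Y s i j\<bar>"]) (auto intro!: sum_nonneg)
    also have "\<dots> \<le> \<kappa>" using \<kappa>(1)[OF that(3)] by simp
    finally show ?thesis .
  qed
  then show ?thesis
    using bform_bound[of I "Y _" \<kappa>] \<kappa>(2) by (intro exI[of _ "\<kappa> * card I"]) auto
qed

text \<open>Along solutions of \<open>\<phi>' = - a \<phi>\<close> the form \<open>\<phi>\<^sup>T Y \<phi>\<close> has derivative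
  \<open>\<Sum>k. (N k \<phi>)\<^sup>T Y (N k \<phi>)\<close>; integrating repeatedly improves an a priori lower bound by
  a factor \<open>c t / n\<close> in the \<open>n\<close>-th step.\<close>

lemma lyap_flow_psd:
  assumes fin: "finite I" and Y: "lyap_flow I m a N Y" and Y0: "psd I (Y 0)" and T: "T \<ge> 0"
  shows "psd I (Y T)"
proof -
  obtain K where K: "K \<ge> 0" "\<And>t v. t \<in> {0..T} \<Longrightarrow> \<bar>bform I (Y t) v v\<bar> \<le> K * (\<Sum>i\<in>I. (v i)\<^sup>2)"
    using lyap_flow_bounded[OF fin Y, of T] by blast
  obtain \<nu> where \<nu>: "\<nu> \<ge> 0" "\<And>v. (\<Sum>k<m. \<Sum>i\<in>I. (mvec I (N k) v i)\<^sup>2) \<le> \<nu> * (\<Sum>i\<in>I. (v i)\<^sup>2)"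
    using mvec_square_bound_exists[OF fin, where m=m and N=N] by blast
  obtain M where M: "M \<ge> 0" "\<forall>t\<in>{0..T}. \<forall>v. \<exists>\<phi>. \<phi> t = v \<and>
    (\<forall>s. \<forall>i\<in>I. ((\<lambda>s. \<phi> s i) has_real_derivative - mvec I a (\<phi> s) i) (at s)) \<and>
    (\<forall>s\<in>{0..t}. (\<Sum>i\<in>I. (\<phi> s i)\<^sup>2) \<le> M * (\<Sum>i\<in>I. (v i)\<^sup>2))"
    using backward_flow_exists[OF fin T, of a] by (elim exE conjE) (erule (1) that)
  \<comment> \<open>K bounds the form of Y on [0,T], \<open>\<nu>\<close> bounds sum_k |N_k v|^2 and
    M bounds the backward flow; one iteration contributes one factor \<open>\<nu> * M\<close> and
    one integration in time.\<close>
  have bound: "- (K * (\<nu> * M * t) ^ n / fact n) * (\<Sum>i\<in>I. (v i)\<^sup>2) \<le> bform I (Y t) v v"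
    if "t \<in> {0..T}" for n t v
    using that
  proof (induction n arbitrary: t v)
    case 0
    then show ?case using K(2)[of t v] by auto
  next
    case (Suc n)
    define V where "V = (\<Sum>i\<in>I. (v i)\<^sup>2)"
    define c where "c = K * (\<nu> * M) ^ Suc n * V"
    obtain \<phi> where \<phi>: "\<phi> t = v"
      "\<And>s i. i \<in> I \<Longrightarrow> ((\<lambda>s. \<phi> s i) has_real_derivative - mvec I a (\<phi> s) i) (at s)"
      "\<And>s. s \<in> {0..t} \<Longrightarrow> (\<Sum>i\<in>I. (\<phi> s i)\<^sup>2) \<le> M * V"
      using spec[OF bspec[OF M(2) Suc.prems], of v] by (elim exE conjE) (simp add: V_def that)
    \<comment> \<open>The added monomial is the integral of the largest loss rate that the n-th
      bound permits, so g is nondecreasing, and g 0 >= 0 because Y starts positive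
      semidefinite.\<close>
    define g where "g s = bform I (Y s) (\<phi> s) (\<phi> s) + c * s ^ Suc n / fact (Suc n)" for s
    have "g 0 \<le> g t"
    proof (rule DERIV_nonneg_imp_nondecreasing[where f=g])
      show "0 \<le> t" using Suc.prems by simp
      fix s assume s: "0 \<le> s" "s \<le> t"
      let ?d = "\<Sum>k<m. bform I (Y s) (mvec I (N k) (\<phi> s)) (mvec I (N k) (\<phi> s))"
      have neg: "bform I (Y s) (\<lambda>i. - mvec I a (\<phi> s) i) w = - bform I (Y s) (mvec I a (\<phi> s)) w"
        "bform I (Y s) w (\<lambda>i. - mvec I a (\<phi> s) i) = - bform I (Y s) w (mvec I a (\<phi> s))" for w
        by (simp_all add: bform_def sum_negf)
      have "((\<lambda>s. bform I (Y s) (\<phi> s) (\<phi> s)) has_real_derivative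
         (bform I (Y s) (\<lambda>i. - mvec I a (\<phi> s) i) (\<phi> s) + bform I (adj_lyap I m a N (Y s)) (\<phi> s) (\<phi> s)
          + bform I (Y s) (\<phi> s) (\<lambda>i. - mvec I a (\<phi> s) i))) (at s)"
        using Y by (intro bform_has_derivative \<phi>(2)) (auto simp: lyap_flow_def)
      then have "((\<lambda>s. bform I (Y s) (\<phi> s) (\<phi> s)) has_real_derivative ?d) (at s)"
        by (simp add: bform_adj_lyap neg)
      moreover have "((\<lambda>s. c * s ^ Suc n / fact (Suc n)) has_real_derivative c * s ^ n / fact n) (at s)"
      proof -
        have "((\<lambda>s. c / fact (Suc n) * s ^ Suc n) has_real_derivative
            c / fact (Suc n) * (real (Suc n) * s ^ n)) (at s)"
          using DERIV_cmult[OF DERIV_pow[of "Suc n" s], of "c / fact (Suc n)"] by simp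
        moreover have "c / fact (Suc n) * (real (Suc n) * s ^ n) = c * s ^ n / fact n"
          by (simp add: field_simps del: of_nat_Suc)
        ultimately show ?thesis by simp
      qed
      ultimately have "(g has_real_derivative ?d + c * s ^ n / fact n) (at s)"
        unfolding g_def by (rule DERIV_add)
      moreover have "0 \<le> ?d + c * s ^ n / fact n"
      proof -
        define e where "e = K * (\<nu> * M * s) ^ n / fact n"
        have e0: "e \<ge> 0" using K(1) \<nu>(1) M(1) s by (simp add: e_def)
        \<comment> \<open>The induction hypothesis is used at time s for each vector N_k phi(s), not
          for phi(s); this is why the bound must hold for all times and all vectors at once.\<close>
        have "- e * (\<Sum>k<m. \<Sum>i\<in>I. (mvec I (N k) (\<phi> s) i)\<^sup>2) \<le> ?d"
          unfolding sum_distrib_left e_def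
          using Suc.IH[of s] s Suc.prems by (intro sum_mono) (auto simp: sum_distrib_left)
        moreover have "e * (\<Sum>k<m. \<Sum>i\<in>I. (mvec I (N k) (\<phi> s) i)\<^sup>2) \<le> e * (\<nu> * (M * V))"
          using \<phi>(3)[of s] s \<nu> e0
          by (intro mult_left_mono order_trans[OF \<nu>(2)]) auto
        moreover have "e * (\<nu> * (M * V)) = c * s ^ n / fact n"
          by (simp add: e_def c_def power_mult_distrib mult_ac)
        ultimately show ?thesis by simp
      qed
      ultimately show "\<exists>y. (g has_real_derivative y) (at s) \<and> 0 \<le> y" by blast
    qed
    moreover have "0 \<le> g 0" using Y0 by (simp add: g_def psd_def)
    ultimately have "- (c * t ^ Suc n / fact (Suc n)) \<le> bform I (Y t) v v"
      by (simp add: g_def \<phi>(1))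
    moreover have "c * t ^ Suc n / fact (Suc n) = K * (\<nu> * M * t) ^ Suc n / fact (Suc n) * V"
      by (simp add: c_def power_mult_distrib mult_ac)
    ultimately show ?case by (simp add: V_def del: power_Suc fact_Suc)
  qed
  have "0 \<le> bform I (Y T) v v" for v
  proof -
    \<comment> \<open>The factorial beats the power, so the lower bound tends to 0.\<close>
    have "(\<lambda>n. inverse (fact n) * (\<nu> * M * T) ^ n) \<longlonglongrightarrow> 0"
      by (rule summable_LIMSEQ_zero[OF summable_exp])
    then have "(\<lambda>n. - (K * (inverse (fact n) * (\<nu> * M * T) ^ n)) * (\<Sum>i\<in>I. (v i)\<^sup>2))
        \<longlonglongrightarrow> - (K * 0) * (\<Sum>i\<in>I. (v i)\<^sup>2)"
      by (intro tendsto_intros)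
    then have "(\<lambda>n. - (K * (\<nu> * M * T) ^ n / fact n) * (\<Sum>i\<in>I. (v i)\<^sup>2)) \<longlonglongrightarrow> 0"
      by (simp add: divide_inverse mult_ac)
    then show ?thesis
      using bound[where t=T and v=v] T by (intro LIMSEQ_le_const2) auto
  qed
  then show ?thesis by (simp add: psd_def)
qed


text \<open>Testing with e_i + e_j and e_i - e_j gives 2 |M_ij| <= M_ii + M_jj, and each diagonal
  entry is at most the trace because all of them are nonnegative.\<close>

lemma psd_entry_le_trace:
  assumes fin: "finite I" and M: "psd I M" and sym: "\<And>i j. M i j = M j i" and ij: "i \<in> I" "j \<in> I"
  shows "\<bar>M i j\<bar> \<le> (\<Sum>l\<in>I. M l l)"
proof -
  have diag: "0 \<le> M l l" if "l \<in> I" for l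
    using M bform_unit[OF fin that that, of M] by (metis psd_def)
  have le: "M l l \<le> (\<Sum>l\<in>I. M l l)" if "l \<in> I" for l
    using that fin diag by (intro member_le_sum) auto
  have "0 \<le> M i i + c * (M i j + M j i) + c\<^sup>2 * M j j" for c
  proof -
    let ?e = "\<lambda>i l. if l = i then 1 else 0 :: real"
    have "0 \<le> bform I M (\<lambda>l. ?e i l + c * ?e j l) (\<lambda>l. ?e i l + c * ?e j l)"
      using M by (simp only: psd_def)
    also have "\<dots> = M i i + c * (M i j + M j i) + c\<^sup>2 * M j j"
      unfolding bform_add_vec using fin ij by (simp only: bform_unit)
    finally show ?thesis .
  qed
  from this[of 1] this[of "-1"] have "2 * \<bar>M i j\<bar> \<le> M i i + M j j"
    using sym[of i j] by (simp add: abs_if)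
  with le[OF ij(1)] le[OF ij(2)] show ?thesis by simp
qed

text \<open>Duality moves the operator from Y to P, where the Lyapunov equation replaces it by - b
  b^T.\<close>

lemma pairing_has_derivative:
  assumes Y: "lyap_flow I m a N Y"
    and P: "\<And>i j. i \<in> I \<Longrightarrow> j \<in> I \<Longrightarrow> lyap I m a N P i j = - (\<Sum>k<m. b i k * b j k)"
  shows "((\<lambda>s. \<Sum>i\<in>I. \<Sum>j\<in>I. P i j * Y s i j) has_real_derivative
    - (\<Sum>k<m. bform I (Y t) (\<lambda>i. b i k) (\<lambda>i. b i k))) (at t)"
proof -
  have "((\<lambda>s. \<Sum>i\<in>I. \<Sum>j\<in>I. P i j * Y s i j) has_real_derivative
      (\<Sum>i\<in>I. \<Sum>j\<in>I. P i j * adj_lyap I m a N (Y t) i j)) (at t)"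
    using Y by (intro DERIV_sum DERIV_cmult) (auto simp: lyap_flow_def)
  also have "(\<Sum>i\<in>I. \<Sum>j\<in>I. P i j * adj_lyap I m a N (Y t) i j)
      = (\<Sum>i\<in>I. \<Sum>j\<in>I. - (\<Sum>k<m. b i k * b j k) * Y t i j)"
    unfolding sum_mult_adj_lyap by (intro sum.cong refl) (simp add: P)
  also have "\<dots> = - bform I (\<lambda>i j. \<Sum>k<m. b i k * Y t i j * b j k) (\<lambda>_. 1) (\<lambda>_. 1)"
    by (simp add: bform_def sum_negf sum_distrib_left sum_distrib_right mult_ac)
  also have "\<dots> = - (\<Sum>k<m. bform I (Y t) (\<lambda>i. b i k) (\<lambda>i. b i k))"
    unfolding bform_sum by (simp add: bform_def)
  finally show ?thesis .
qed

text \<open>The flow \<open>Z\<close> started at the supersolution \<open>S\<close> satisfies \<open>- Z' \<ge> Y\<close>, so the trace of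
  \<open>Y\<close> is integrable on the half-line; the nonincreasing pairing with \<open>P\<close> is bounded by a multiple
  of that trace and hence cannot become negative.\<close>

lemma pairing_nonneg:
  assumes fin: "finite I" and Y: "lyap_flow I m a N Y" and sym: "\<And>t i j. Y t i j = Y t j i"
    and Y0: "psd I (Y 0)"
    and P: "\<And>i j. i \<in> I \<Longrightarrow> j \<in> I \<Longrightarrow> lyap I m a N P i j = - (\<Sum>k<m. b i k * b j k)"
    and S: "psd I S" and super: "\<And>v. bform I (adj_lyap I m a N S) v v \<le> - bform I (Y 0) v v"
    and t0: "t0 \<ge> 0"
  shows "0 \<le> (\<Sum>i\<in>I. \<Sum>j\<in>I. P i j * Y t0 i j)"
proof (rule ccontr)
  define \<gamma> where "\<gamma> t = (\<Sum>i\<in>I. \<Sum>j\<in>I. P i j * Y t i j)" for t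
  assume "\<not> 0 \<le> (\<Sum>i\<in>I. \<Sum>j\<in>I. P i j * Y t0 i j)"
  then have neg: "\<gamma> t0 < 0" by (simp add: \<gamma>_def)
  have psdY: "psd I (Y t)" if "t \<ge> 0" for t using lyap_flow_psd[OF fin Y Y0 that] .
  obtain Z where Z: "lyap_flow I m a N Z" and Z0: "\<And>i j. Z 0 i j = S i j"
    using lyap_flow_exists[OF fin, of m a N S] by blast
  have "Z 0 = S" using Z0 by blast
  then have psdZ: "psd I (Z t)" if "t \<ge> 0" for t using lyap_flow_psd[OF fin Z _ that] S by simp
  \<comment> \<open>W = - Z' - Y is itself a solution of the flow equation, and at time 0 its
    positivity is the supersolution inequality. Positivity then persists, so Z' <= - Y for all later
    times.\<close>
  define W where "W t i j = (-1) * adj_lyap I m a N (Z t) i j + (-1) * Y t i j" for t i j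
  have W: "lyap_flow I m a N W"
    using lyap_flow_linear[OF lyap_flow_generator[OF Z] Y, of "-1" "-1"] by (simp add: W_def[abs_def])
  have "psd I (W 0)"
    unfolding psd_def W_def bform_linear using super \<open>Z 0 = S\<close> by (simp add: algebra_simps)
  then have psdW: "psd I (W t)" if "t \<ge> 0" for t using lyap_flow_psd[OF fin W _ that] by simp
  have diag: "0 \<le> M i i" if "psd I M" "i \<in> I" for M i
    using that bform_unit[OF fin \<open>i \<in> I\<close> \<open>i \<in> I\<close>, of M] by (metis psd_def)
  define \<tau> where "\<tau> t = (\<Sum>i\<in>I. Y t i i)" for t
  define \<zeta> where "\<zeta> t = (\<Sum>i\<in>I. Z t i i)" for t
  define \<kappa> where "\<kappa> = (\<Sum>i\<in>I. \<Sum>j\<in>I. \<bar>P i j\<bar>)"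
  have \<kappa>0: "\<kappa> \<ge> 0" by (auto simp: \<kappa>_def intro!: sum_nonneg)
  have \<zeta>0: "\<zeta> t \<ge> 0" if "t \<ge> 0" for t
    unfolding \<zeta>_def using diag[OF psdZ[OF that]] by (intro sum_nonneg) auto
  have \<zeta>': "(\<zeta> has_real_derivative (\<Sum>i\<in>I. adj_lyap I m a N (Z t) i i)) (at t)" for t
    unfolding \<zeta>_def using Z by (intro DERIV_sum) (auto simp: lyap_flow_def)
  have \<zeta>'_le: "(\<Sum>i\<in>I. adj_lyap I m a N (Z t) i i) \<le> - \<tau> t" if "t \<ge> 0" for t
  proof -
    have "0 \<le> (\<Sum>i\<in>I. W t i i)" using diag[OF psdW[OF that]] by (intro sum_nonneg) auto
    also have "\<dots> = - (\<Sum>i\<in>I. adj_lyap I m a N (Z t) i i) - \<tau> t"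
      by (simp add: W_def \<tau>_def sum_subtractf sum_negf)
    finally show ?thesis by simp
  qed
  have \<gamma>_le: "- \<gamma> t \<le> \<kappa> * \<tau> t" if "t \<ge> 0" for t
  proof -
    have "- \<gamma> t \<le> (\<Sum>i\<in>I. \<Sum>j\<in>I. \<bar>P i j\<bar> * \<tau> t)"
      unfolding \<gamma>_def sum_negf[symmetric]
    proof (intro sum_mono)
      fix i j assume "i \<in> I" "j \<in> I"
      have "- (P i j * Y t i j) \<le> \<bar>P i j\<bar> * \<bar>Y t i j\<bar>" by (simp add: abs_mult[symmetric])
      also have "\<dots> \<le> \<bar>P i j\<bar> * \<tau> t"
        using psd_entry_le_trace[OF fin psdY[OF that] sym \<open>i \<in> I\<close> \<open>j \<in> I\<close>]
        by (intro mult_left_mono) (auto simp: \<tau>_def)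
      finally show "- (P i j * Y t i j) \<le> \<bar>P i j\<bar> * \<tau> t" .
    qed
    then show ?thesis by (simp add: \<kappa>_def sum_distrib_right)
  qed
  have mono: "\<gamma> t \<le> \<gamma> t0" if "t \<ge> t0" for t
  proof (rule DERIV_nonpos_imp_nonincreasing[OF that])
    fix s assume "t0 \<le> s" "s \<le> t"
    then have "0 \<le> (\<Sum>k<m. bform I (Y s) (\<lambda>i. b i k) (\<lambda>i. b i k))"
      using psdY[of s] t0 by (intro sum_nonneg) (auto simp: psd_def)
    then show "\<exists>y. (\<gamma> has_real_derivative y) (at s) \<and> y \<le> 0"
      using pairing_has_derivative[OF Y P, of s] unfolding \<gamma>_def by (intro exI conjI) auto
  qed
  \<comment> \<open>After \<open>t0\<close> the pairing stays below its negative value there, hence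
    \<open>\<kappa> * \<tau>\<close> stays above the constant - gamma(t0). Since
    \<open>\<tau>\<close> is at most the decay rate of \<open>\<zeta>\<close>, h is nonincreasing,
    although its linear part is unbounded and \<open>\<zeta>\<close> cannot be negative.\<close>
  define h where "h t = \<kappa> * \<zeta> t + (- \<gamma> t0) * t" for t
  have h_le: "h t \<le> h t0" if "t \<ge> t0" for t
  proof (rule DERIV_nonpos_imp_nonincreasing[OF that])
    fix s assume s: "t0 \<le> s" "s \<le> t"
    have "(h has_real_derivative (\<kappa> * (\<Sum>i\<in>I. adj_lyap I m a N (Z s) i i) + (- \<gamma> t0) * 1)) (at s)"
      unfolding h_def by (intro DERIV_add DERIV_cmult DERIV_ident \<zeta>')
    moreover have "\<kappa> * (\<Sum>i\<in>I. adj_lyap I m a N (Z s) i i) \<le> \<kappa> * - \<tau> s"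
      using \<zeta>'_le[of s] s t0 \<kappa>0 by (intro mult_left_mono) auto
    moreover have "- \<gamma> t0 \<le> \<kappa> * \<tau> s" using mono[of s] \<gamma>_le[of s] s t0 by simp
    ultimately show "\<exists>y. (h has_real_derivative y) (at s) \<and> y \<le> 0" by (intro exI conjI) auto
  qed
  \<comment> \<open>The quotient makes the linear part of h reach \<open>h t0\<close>, the added 1
    makes it exceed that value, and the maximum keeps t in the range where h is
    nonincreasing.\<close>
  define t where "t = max t0 (h t0 / (- \<gamma> t0) + 1)"
  have "(- \<gamma> t0) * (h t0 / (- \<gamma> t0) + 1) \<le> (- \<gamma> t0) * t"
    using neg by (intro mult_left_mono) (auto simp: t_def)
  moreover have "(- \<gamma> t0) * (h t0 / (- \<gamma> t0) + 1) = h t0 - \<gamma> t0" using neg by (simp add: field_simps)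
  ultimately have "h t0 < (- \<gamma> t0) * t" using neg by linarith
  also have "\<dots> \<le> h t" using \<kappa>0 \<zeta>0[of t] t0 by (simp add: h_def t_def)
  also have "\<dots> \<le> h t0" by (rule h_le) (simp add: t_def)
  finally show False by simp
qed

subsection \<open>The output bound\<close>


lemma bform_add_left: "bform I M (\<lambda>i. v i + w i) z = bform I M v z + bform I M w z"
  by (simp add: bform_def distrib_right sum.distrib)

lemma bform_add_right: "bform I M z (\<lambda>i. v i + w i) = bform I M z v + bform I M z w"
  by (simp add: bform_def distrib_left sum.distrib)

lemma bform_sum_left: "bform I M (\<lambda>i. \<Sum>k<(m::nat). c k * v k i) z = (\<Sum>k<m. c k * bform I M (v k) z)"
proof (induction m)
  case (Suc m)
  have "bform I M (\<lambda>i. c m * v m i) z = c m * bform I M (v m) z"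
    by (simp add: bform_def sum_distrib_left mult_ac)
  with Suc show ?case by (simp add: bform_add_left)
qed (simp add: bform_def)

lemma bform_sum_right: "bform I M z (\<lambda>i. \<Sum>k<(m::nat). c k * v k i) = (\<Sum>k<m. c k * bform I M z (v k))"
  using bform_sum_left[where I=I and M="\<lambda>i j. M j i" and m=m and c=c and v=v and z=z] by (simp only: bform_transpose[of I M])

lemma bform_gram:
  "bform I (\<lambda>i j. \<Sum>o'<p. c o' i * c o' j) v v = (\<Sum>o'<p. (\<Sum>i\<in>I. c o' i * v i)\<^sup>2)"
  unfolding bform_sum
  by (simp add: bform_def power2_eq_square sum_product mult_ac)

text \<open>The discriminant of the nonnegative quadratic c |-> form of v + c w. The linear
  coefficient is the symmetrised cross term, whence the factor 4.\<close>

lemma psd_cauchy_schwarz: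
  assumes "psd I M"
  shows "(bform I M v w + bform I M w v)\<^sup>2 \<le> 4 * bform I M v v * bform I M w w"
proof -
  define B where "B = bform I M v w + bform I M w v"
  define p where "p = bform I M v v"
  define q where "q = bform I M w w"
  have quad: "0 \<le> p + c * B + c\<^sup>2 * q" for c
    using assms unfolding psd_def B_def p_def q_def by (metis bform_add_vec)
  have q0: "0 \<le> q" using assms by (simp add: psd_def q_def)
  have "B\<^sup>2 \<le> 4 * p * q"
  proof (cases "q = 0")
    case True
    have "B = 0"
    proof (rule ccontr)
      assume "B \<noteq> 0"
      \<comment> \<open>For q = 0 the quadratic is affine, and this c makes it equal to -1.\<close>
      then have "p + (- (p + 1) / B) * B = -1" by simp
      with quad[of "- (p + 1) / B"] True show False by simp
    qed
    with True show ?thesis by simp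
  next
    case False
    then have "q > 0" using q0 by simp
    \<comment> \<open>The minimiser of the quadratic.\<close>
    have "p + (- B / (2 * q)) * B + (- B / (2 * q))\<^sup>2 * q = p - B\<^sup>2 / (4 * q)"
      using \<open>q > 0\<close> by (simp add: field_simps power2_eq_square)
    with quad[of "- B / (2 * q)"] have "B\<^sup>2 / (4 * q) \<le> p" by simp
    with \<open>q > 0\<close> show ?thesis by (simp add: field_simps)
  qed
  then show ?thesis by (simp add: B_def p_def q_def)
qed

text \<open>Young's inequality on top of Cauchy-Schwarz. The weight G is left free because it will
  vary with time.\<close>

lemma psd_weighted_cross_le:
  assumes "psd I M" "G > 0"
  shows "c * (bform I M v w + bform I M w v) \<le> G * c\<^sup>2 + bform I M v v * bform I M w w / G"
proof -
  define B where "B = bform I M v w + bform I M w v"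
  have "0 \<le> (2 * G * c - B)\<^sup>2" by simp
  then have "4 * G * (c * B) \<le> 4 * G * (G * c\<^sup>2) + B\<^sup>2"
    by (simp add: power2_eq_square algebra_simps)
  also have "\<dots> \<le> 4 * G * (G * c\<^sup>2) + 4 * bform I M v v * bform I M w w"
    using psd_cauchy_schwarz[OF assms(1), of v w] by (simp add: B_def)
  also have "\<dots> = 4 * G * (G * c\<^sup>2 + bform I M v v * bform I M w w / G)"
    using assms(2) by (simp add: field_simps)
  finally have "4 * G * (c * B) \<le> 4 * G * (G * c\<^sup>2 + bform I M v v * bform I M w w / G)" .
  then show ?thesis using assms(2) by (simp add: B_def)
qed

text \<open>The \<open>a\<close> terms cancel. Each input term is split by the weighted cross
  estimate, which puts b_k^T Y b_k in front of x^T Y x / G. Each bilinear term is set against the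
  N_k^T Y N_k part of the adjoint operator, and only the indices in K contribute.\<close>

lemma dissipation_inequality:
  assumes Y: "psd I Y" and G: "G > 0" and K: "K \<subseteq> {..<m}"
    and N0: "\<And>k i j. k < m \<Longrightarrow> k \<notin> K \<Longrightarrow> i \<in> I \<Longrightarrow> j \<in> I \<Longrightarrow> N k i j = 0"
    and x': "\<And>i. x' i = mvec I a x i + (\<Sum>k<m. u k * b i k) + (\<Sum>k<m. u k * mvec I (N k) x i)"
  shows "bform I Y x' x + bform I Y x x' - bform I (adj_lyap I m a N Y) x x
    \<le> G * (\<Sum>k<m. (u k)\<^sup>2) + (\<Sum>k<m. bform I Y (\<lambda>i. b i k) (\<lambda>i. b i k)) * bform I Y x x / G
      + (\<Sum>k\<in>K. (u k)\<^sup>2) * bform I Y x x"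
proof -
  let ?b = "\<lambda>k i. b i k" and ?N = "\<lambda>k. mvec I (N k) x"
  have x'_eq: "x' = (\<lambda>i. mvec I a x i + (\<Sum>k<m. u k * ?b k i) + (\<Sum>k<m. u k * ?N k i))"
    using x' by blast
  have eq: "bform I Y x' x + bform I Y x x' - bform I (adj_lyap I m a N Y) x x
      = (\<Sum>k<m. u k * (bform I Y (?b k) x + bform I Y x (?b k)))
        + (\<Sum>k<m. u k * (bform I Y (?N k) x + bform I Y x (?N k)) - bform I Y (?N k) (?N k))"
    unfolding x'_eq bform_adj_lyap bform_add_left bform_add_right bform_sum_left bform_sum_right
    by (simp add: sum.distrib sum_subtractf distrib_left)
  have 1: "(\<Sum>k<m. u k * (bform I Y (?b k) x + bform I Y x (?b k)))
      \<le> (\<Sum>k<m. G * (u k)\<^sup>2 + bform I Y (?b k) (?b k) * bform I Y x x / G)"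
    by (intro sum_mono psd_weighted_cross_le[OF Y G])
  have 2: "(\<Sum>k<m. u k * (bform I Y (?N k) x + bform I Y x (?N k)) - bform I Y (?N k) (?N k))
      \<le> (\<Sum>k<m. if k \<in> K then (u k)\<^sup>2 * bform I Y x x else 0)"
  proof (intro sum_mono)
    fix k assume "k \<in> {..<m}"
    show "u k * (bform I Y (?N k) x + bform I Y x (?N k)) - bform I Y (?N k) (?N k)
        \<le> (if k \<in> K then (u k)\<^sup>2 * bform I Y x x else 0)"
    proof (cases "k \<in> K")
      case True
      \<comment> \<open>Completing the square with N_k x - u_k x.\<close>
      have "0 \<le> bform I Y (\<lambda>i. ?N k i + (- u k) * x i) (\<lambda>i. ?N k i + (- u k) * x i)"
        using Y by (simp only: psd_def)
      also have "\<dots> = bform I Y (?N k) (?N k) - u k * (bform I Y (?N k) x + bform I Y x (?N k))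
          + (u k)\<^sup>2 * bform I Y x x"
        unfolding bform_add_vec by simp
      finally show ?thesis using True by simp
    next
      case False
      have "?N k i = 0" if "i \<in> I" for i
        using N0 \<open>k \<in> {..<m}\<close> False that by (auto simp: mvec_def)
      then have "bform I Y (?N k) z = 0" "bform I Y z (?N k) = 0" for z
        by (auto simp: bform_def)
      with False show ?thesis by simp
    qed
  qed
  have "(\<Sum>k<m. if k \<in> K then (u k)\<^sup>2 * bform I Y x x else 0) = (\<Sum>k\<in>K. (u k)\<^sup>2 * bform I Y x x)"
    using K by (subst sum.inter_restrict[symmetric]) (auto simp: Int_absorb1)
  with eq 1 2 show ?thesis
    by (simp add: sum.distrib sum_distrib_left sum_distrib_right sum_divide_distrib)
qed

lemma has_density_bform:
  assumes fin: "finite I"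
    and v: "\<And>i. i \<in> I \<Longrightarrow> has_density T (\<lambda>t. v t i) (\<lambda>t. v' t i)"
    and Y: "\<And>i j. i \<in> I \<Longrightarrow> j \<in> I \<Longrightarrow> has_density T (\<lambda>t. Y t i j) (\<lambda>t. Y' t i j)"
  shows "has_density T (\<lambda>t. bform I (Y t) (v t) (v t))
     (\<lambda>t. bform I (Y t) (v' t) (v t) + bform I (Y' t) (v t) (v t) + bform I (Y t) (v t) (v' t))"
proof -
  have "has_density T (\<lambda>t. \<Sum>i\<in>I. \<Sum>j\<in>I. v t i * Y t i j * v t j)
     (\<lambda>t. \<Sum>i\<in>I. \<Sum>j\<in>I. (v' t i * Y t i j + v t i * Y' t i j) * v t j + v t i * Y t i j * v' t j)"
    by (intro has_density_sum fin has_density_mult v Y)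
  then show ?thesis
    by (rule has_density_cong) (simp_all add: bform_def distrib_right sum.distrib)
qed

lemma lyap_flow_continuous:
  assumes "lyap_flow I m a N Y" "i \<in> I" "j \<in> I"
  shows "continuous_on A (\<lambda>s. Y s i j)"
  using assms unfolding lyap_flow_def
  by (intro continuous_at_imp_continuous_on ballI) (blast intro: DERIV_isCont)

lemma reversed_derivative:
  assumes "(f has_real_derivative D) (at (T - s))"
  shows "((\<lambda>s. f (T - s)) has_real_derivative - D) (at s)"
proof -
  have "((\<lambda>s. T - s) has_real_derivative - 1) (at s)" by (auto intro!: derivative_eq_intros)
  from DERIV_chain2[OF assms this] show ?thesis by simp
qed

text \<open>The supply \<open>G s = \<gamma> (T - s) + d\<close> is chosen so that its growth pays for the input term in the
  dissipation inequality: \<open>v = (x\<^sup>T Y x / G) exp (- h)\<close> has density at most \<open>\<bar>u\<bar>\<^sup>2\<close>.\<close>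

lemma bilinear_output_bound:
  fixes x :: "real \<Rightarrow> 'i \<Rightarrow> real" and u :: "real \<Rightarrow> nat \<Rightarrow> real"
  assumes fin: "finite I" and T: "T \<ge> 0" and K: "K \<subseteq> {..<m}"
    and N0: "\<And>k i j. k < m \<Longrightarrow> k \<notin> K \<Longrightarrow> i \<in> I \<Longrightarrow> j \<in> I \<Longrightarrow> N k i j = 0"
    and x0: "\<And>i. i \<in> I \<Longrightarrow> x 0 i = 0"
    and x: "\<And>i. i \<in> I \<Longrightarrow> has_density T (\<lambda>t. x t i)
      (\<lambda>s. mvec I a (x s) i + (\<Sum>k<m. u s k * b i k) + (\<Sum>k<m. u s k * mvec I (N k) (x s) i))"
    and u2: "\<And>k. k < m \<Longrightarrow> (\<lambda>s. (u s k)\<^sup>2) absolutely_integrable_on {0..T}"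
    and P: "\<And>i j. i \<in> I \<Longrightarrow> j \<in> I \<Longrightarrow> lyap I m a N P i j = - (\<Sum>k<m. b i k * b j k)"
    and S: "psd I S"
    and super: "\<And>v. bform I (adj_lyap I m a N S) v v \<le> - (\<Sum>o'<p. (\<Sum>i\<in>I. c o' i * v i)\<^sup>2)"
  shows "(\<Sum>o'<p. (\<Sum>i\<in>I. c o' i * x T i)\<^sup>2) \<le> (\<Sum>i\<in>I. \<Sum>j\<in>I. P i j * (\<Sum>o'<p. c o' i * c o' j))
     * exp (integral {0..T} (\<lambda>s. \<Sum>k\<in>K. (u s k)\<^sup>2)) * integral {0..T} (\<lambda>s. \<Sum>k<m. (u s k)\<^sup>2)"
    and "0 \<le> (\<Sum>i\<in>I. \<Sum>j\<in>I. P i j * (\<Sum>o'<p. c o' i * c o' j))"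
proof -
  define Y0 where "Y0 i j = (\<Sum>o'<p. c o' i * c o' j)" for i j
  have Y0_form: "bform I Y0 v v = (\<Sum>o'<p. (\<Sum>i\<in>I. c o' i * v i)\<^sup>2)" for v
    unfolding Y0_def[abs_def] by (rule bform_gram)
  obtain Y where Y: "lyap_flow I m a N Y" and Y_init: "\<And>i j. Y 0 i j = Y0 i j"
    and sym: "\<And>t i j. Y t i j = Y t j i"
    using symmetric_lyap_flow_exists[OF fin, of Y0 m a N] by (auto simp: Y0_def mult.commute)
  have Y_0: "Y 0 = Y0" using Y_init by blast
  have psd0: "psd I (Y 0)" unfolding Y_0 psd_def Y0_form by (auto intro!: sum_nonneg)
  have psdY: "psd I (Y t)" if "t \<ge> 0" for t using lyap_flow_psd[OF fin Y psd0 that] .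
  define \<gamma> where "\<gamma> t = (\<Sum>i\<in>I. \<Sum>j\<in>I. P i j * Y t i j)" for t
  define \<beta> where "\<beta> t = (\<Sum>k<m. bform I (Y t) (\<lambda>i. b i k) (\<lambda>i. b i k))" for t
  have \<gamma>0: "\<gamma> t \<ge> 0" if "t \<ge> 0" for t
    unfolding \<gamma>_def using super by (intro pairing_nonneg[OF fin Y sym psd0 P S _ that]) (auto simp: Y_0 Y0_form)
  have \<gamma>': "(\<gamma> has_real_derivative - \<beta> t) (at t)" for t
    using pairing_has_derivative[OF Y P, of t] unfolding \<gamma>_def[abs_def] \<beta>_def by simp
  have \<beta>_cont: "continuous_on A \<beta>" for A
    unfolding \<beta>_def[abs_def] bform_def by (intro continuous_intros lyap_flow_continuous[OF Y])
  have adj_cont: "continuous_on A (\<lambda>s. adj_lyap I m a N (Y s) i j)" if "i \<in> I" "j \<in> I" for A i j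
    by (rule lyap_flow_continuous[OF lyap_flow_generator[OF Y] that])
  define x' where "x' s i = mvec I a (x s) i + (\<Sum>k<m. u s k * b i k) + (\<Sum>k<m. u s k * mvec I (N k) (x s) i)" for s i
  \<comment> \<open>Y runs backward: at s = T the matrix is \<open>Y0\<close> and w is the squared
    output, while w 0 = 0 because the trajectory starts at the origin.\<close>
  define w where "w s = bform I (Y (T - s)) (x s) (x s)" for s
  define w' where "w' s = bform I (Y (T - s)) (x' s) (x s) + bform I (\<lambda>i j. - adj_lyap I m a N (Y (T - s)) i j) (x s) (x s)
      + bform I (Y (T - s)) (x s) (x' s)" for s
  have rev_cont: "continuous_on A (\<lambda>s. f (T - s))" if "\<And>A. continuous_on A f" for A and f :: "real \<Rightarrow> real"
    by (rule continuous_on_compose2[OF that[of UNIV]]) (auto intro!: continuous_intros)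
  have w: "has_density T w w'"
    unfolding w_def w'_def
  proof (intro has_density_bform fin)
    show "has_density T (\<lambda>t. x t i) (\<lambda>t. x' t i)" if "i \<in> I" for i
      using x[OF that] by (simp add: x'_def)
    fix i j assume ij: "i \<in> I" "j \<in> I"
    show "has_density T (\<lambda>t. Y (T - t) i j) (\<lambda>t. - adj_lyap I m a N (Y (T - t)) i j)"
    proof (rule has_density_C1)
      show "((\<lambda>t. Y (T - t) i j) has_real_derivative - adj_lyap I m a N (Y (T - t)) i j) (at t)" for t
        using Y ij by (intro reversed_derivative[where f="\<lambda>t. Y t i j"]) (auto simp: lyap_flow_def)
      show "continuous_on {0..T} (\<lambda>t. - adj_lyap I m a N (Y (T - t)) i j)"
        by (intro continuous_intros rev_cont[where f="\<lambda>s. adj_lyap I m a N (Y s) i j"] adj_cont[OF ij])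
    qed
  qed
  define h' where "h' s = (\<Sum>k\<in>K. (u s k)\<^sup>2)" for s
  define h where "h t = integral {0..t} h'" for t
  define U where "U = integral {0..T} (\<lambda>s. \<Sum>k<m. (u s k)\<^sup>2)"
  have h'0: "h' s \<ge> 0" for s by (auto simp: h'_def intro!: sum_nonneg)
  have finK: "finite K" using K finite_subset by blast
  have "h' absolutely_integrable_on {0..T}"
    unfolding h'_def[abs_def] using K finK by (intro absolutely_integrable_sum u2) auto
  then have h: "has_density T h h'"
    unfolding h_def[abs_def] by (rule has_density_indefinite_integral)
  have exp_h: "has_density T (\<lambda>t. exp (- h t)) (\<lambda>t. - h' t * exp (- h t))"
    by (rule has_density_exp_minus[OF h h'0]) (simp add: h_def)
  have h0: "h s \<ge> 0" if "s \<in> {0..T}" for s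
    using has_integral_nonneg[OF has_density_integral[OF h, of 0 s]] h'0 that by (auto simp: h_def)
  have usq: "((\<lambda>s. \<Sum>k<m. (u s k)\<^sup>2) has_integral U) {0..T}"
    unfolding U_def using u2
    by (intro integrable_integral set_lebesgue_integral_eq_integral(1) absolutely_integrable_sum) auto
  \<comment> \<open>gamma may vanish, so a positive d is added before dividing by it; the limit d ->
    0 is taken at the end.\<close>
  have main: "w T \<le> (\<gamma> 0 + d) * exp (h T) * U" if d: "d > 0" for d
  proof -
    define G where "G s = \<gamma> (T - s) + d" for s
    have Gpos: "G s > 0" if "s \<in> {0..T}" for s using \<gamma>0[of "T - s"] that d by (simp add: G_def)
    have G': "(G has_real_derivative \<beta> (T - s)) (at s)" for s
      using DERIV_add[OF reversed_derivative[OF \<gamma>'[of "T - s"]] DERIV_const[of d]] by (simp add: G_def[abs_def])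
    have G_cont: "continuous_on A G" for A
      using G' by (intro continuous_at_imp_continuous_on ballI) (blast intro: DERIV_isCont)
    have r: "has_density T (\<lambda>s. inverse (G s)) (\<lambda>s. - (\<beta> (T - s) * (inverse (G s))\<^sup>2))"
    proof (rule has_density_C1)
      show "((\<lambda>s. inverse (G s)) has_real_derivative - (\<beta> (T - s) * (inverse (G s))\<^sup>2)) (at s)"
        if "s \<in> {0..T}" for s
        using DERIV_inverse'[OF G'[of s]] Gpos[OF that]
        by (simp add: power2_eq_square mult_ac)
      show "continuous_on {0..T} (\<lambda>s. - (\<beta> (T - s) * (inverse (G s))\<^sup>2))"
        using Gpos by (intro continuous_intros G_cont rev_cont[OF \<beta>_cont]) (metis less_irrefl)
    qed
    define v where "v s = w s * inverse (G s) * exp (- h s)" for s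
    define v' where "v' s = (w' s * inverse (G s) + w s * - (\<beta> (T - s) * (inverse (G s))\<^sup>2)) * exp (- h s)
        + w s * inverse (G s) * (- h' s * exp (- h s))" for s
    have v: "has_density T v v'"
      unfolding v_def[abs_def] v'_def[abs_def] by (intro has_density_mult w r exp_h)
    have v'_le: "v' s \<le> (\<Sum>k<m. (u s k)\<^sup>2)" if s: "s \<in> {0..T}" for s
    proof -
      let ?q = "\<Sum>k<m. (u s k)\<^sup>2" and ?i = "inverse (G s)"
      have neg: "bform I (\<lambda>i j. - M i j) z z = - bform I M z z" for M and z :: "'i \<Rightarrow> real"
        by (simp add: bform_def sum_negf)
      have "w' s = bform I (Y (T - s)) (x' s) (x s) + bform I (Y (T - s)) (x s) (x' s)
          - bform I (adj_lyap I m a N (Y (T - s))) (x s) (x s)"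
        by (simp add: w'_def neg)
      also have "\<dots> \<le> G s * ?q + \<beta> (T - s) * w s / G s + h' s * w s"
        unfolding \<beta>_def w_def h'_def
        using psdY[of "T - s"] s by (intro dissipation_inequality Gpos K N0) (auto simp: x'_def)
      finally have "w' s * ?i \<le> (G s * ?q + \<beta> (T - s) * w s / G s + h' s * w s) * ?i"
        using Gpos[OF s] by (intro mult_right_mono) auto
      \<comment> \<open>The second summand is what the derivative of \<open>inverse (G s)\<close>
        removes and the third is what the derivative of \<open>exp (- h s)\<close> removes, so only
        the input energy survives in v'.\<close>
      also have "\<dots> = ?q + \<beta> (T - s) * w s * ?i\<^sup>2 + h' s * w s * ?i"
        using Gpos[OF s] by (simp add: field_simps power2_eq_square)
      finally have "w' s * ?i - w s * (\<beta> (T - s) * ?i\<^sup>2) - w s * ?i * h' s \<le> ?q"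
        by (simp add: mult_ac)
      then have "(w' s * ?i - w s * (\<beta> (T - s) * ?i\<^sup>2) - w s * ?i * h' s) * exp (- h s) \<le> ?q * exp (- h s)"
        by (intro mult_right_mono) auto
      also have "\<dots> \<le> ?q * 1"
        using h0[OF s] by (intro mult_left_mono sum_nonneg) auto
      finally show ?thesis by (simp add: v'_def algebra_simps)
    qed
    have "v T - v 0 \<le> U"
      using has_integral_le[OF has_density_integral[OF v order_refl T order_refl] usq v'_le] .
    moreover have "v 0 = 0" using x0 by (simp add: v_def w_def bform_def)
    moreover have "v T = w T / ((\<gamma> 0 + d) * exp (h T))"
      by (simp add: v_def G_def exp_minus field_simps)
    moreover have "(\<gamma> 0 + d) * exp (h T) > 0" using \<gamma>0[of 0] d by simp
    ultimately show ?thesis by (simp add: divide_le_eq mult_ac)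
  qed
  have U0: "U \<ge> 0" by (rule has_integral_nonneg[OF usq]) (auto intro!: sum_nonneg)
  have "w T \<le> \<gamma> 0 * exp (h T) * U"
  proof (rule field_le_epsilon)
    fix e :: real assume e: "e > 0"
    \<comment> \<open>Chosen so that the surplus d exp (h T) U is at most e; the 1 in the
      denominator covers U = 0.\<close>
    define d where "d = e / (exp (h T) * U + 1)"
    have pos: "exp (h T) * U + 1 > 0" using U0 by (intro add_nonneg_pos) auto
    then have d: "d > 0" using e by (simp add: d_def)
    have "d * (exp (h T) * U) \<le> d * (exp (h T) * U + 1)" using d by (intro mult_left_mono) auto
    also have "\<dots> = e" using pos by (simp add: d_def)
    finally have "d * (exp (h T) * U) \<le> e" .
    with main[OF d] show "w T \<le> \<gamma> 0 * exp (h T) * U + e" by (simp add: algebra_simps)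
  qed
  then show "(\<Sum>o'<p. (\<Sum>i\<in>I. c o' i * x T i)\<^sup>2) \<le> (\<Sum>i\<in>I. \<Sum>j\<in>I. P i j * (\<Sum>o'<p. c o' i * c o' j))
     * exp (integral {0..T} (\<lambda>s. \<Sum>k\<in>K. (u s k)\<^sup>2)) * integral {0..T} (\<lambda>s. \<Sum>k<m. (u s k)\<^sup>2)"
    by (simp add: w_def Y_0 Y0_form \<gamma>_def Y0_def h_def h'_def[abs_def] U_def cong: sum.cong)
  show "0 \<le> (\<Sum>i\<in>I. \<Sum>j\<in>I. P i j * (\<Sum>o'<p. c o' i * c o' j))"
    using \<gamma>0[of 0] by (simp add: \<gamma>_def Y_0 Y0_def)
qed

text \<open>The integral equation only gives gauge integrability of the whole right-hand side. It
  first makes x continuous, as an indefinite integral; then every summand is a continuous factor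
  times an absolutely integrable control, or continuous itself.\<close>

lemma bilinear_solution_density:
  fixes x :: "real \<Rightarrow> 'i \<Rightarrow> real" and u :: "real \<Rightarrow> nat \<Rightarrow> real"
  assumes T: "T \<ge> 0"
    and sol: "\<And>i t. i \<in> I \<Longrightarrow> t \<in> {0..T} \<Longrightarrow> ((\<lambda>s. mvec I a (x s) i + (\<Sum>k<m. u s k * b i k)
      + (\<Sum>k<m. u s k * mvec I (N k) (x s) i)) has_integral x t i) {0..t}"
    and u: "\<And>k. k < m \<Longrightarrow> (\<lambda>s. u s k) absolutely_integrable_on {0..T}"
    and i: "i \<in> I"
  shows "has_density T (\<lambda>t. x t i)
      (\<lambda>s. mvec I a (x s) i + (\<Sum>k<m. u s k * b i k) + (\<Sum>k<m. u s k * mvec I (N k) (x s) i))"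
    and "x 0 i = 0"
proof -
  have x_cont: "continuous_on {0..T} (\<lambda>t. x t j)" if "j \<in> I" for j
  proof -
    have "continuous_on {0..T} (\<lambda>t. integral {0..t} (\<lambda>s. mvec I a (x s) j + (\<Sum>k<m. u s k * b j k)
      + (\<Sum>k<m. u s k * mvec I (N k) (x s) j)))"
      using sol[OF that, of T] T by (intro indefinite_integral_continuous_1) auto
    then show ?thesis by (rule continuous_on_eq) (rule integral_unique[OF sol[OF that]])
  qed
  have mvec_cont: "continuous_on {0..T} (\<lambda>t. mvec I M (x t) i)" for M
    unfolding mvec_def by (intro continuous_intros x_cont)
  have "(\<lambda>s. mvec I a (x s) i + (\<Sum>k<m. u s k * b i k) + (\<Sum>k<m. u s k * mvec I (N k) (x s) i))
      absolutely_integrable_on {0..T}"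
    using absolutely_integrable_continuous_mult[OF mvec_cont u]
    by (intro set_integral_add absolutely_integrable_sum set_integrable_mult_left u
        absolutely_integrable_continuous_real[OF mvec_cont]) (auto simp: mult.commute)
  moreover show x0: "x 0 i = 0" using integral_unique[OF sol[OF i, of 0]] T by simp
  ultimately show "has_density T (\<lambda>t. x t i)
      (\<lambda>s. mvec I a (x s) i + (\<Sum>k<m. u s k * b i k) + (\<Sum>k<m. u s k * mvec I (N k) (x s) i))"
    using sol[OF i] by (auto simp: has_density_def)
qed

subsection \<open>The error system of a balanced truncation\<close>


text \<open>The block diagonal diag (M, M). Restricted to \<open>{..<n} <+> {..<r}\<close> the
  second copy sees only the leading r x r block, so truncation is built into the index set.\<close>

fun dup :: "(nat \<Rightarrow> nat \<Rightarrow> real) \<Rightarrow> nat + nat \<Rightarrow> nat + nat \<Rightarrow> real" where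
  "dup M (Inl i) (Inl j) = M i j"
| "dup M (Inr i) (Inr j) = M i j"
| "dup M (Inl i) (Inr j) = 0"
| "dup M (Inr i) (Inl j) = 0"

text \<open>The matrix equations entry by entry. Reduced coefficients need no names of their own:
  they are the full ones at indices below r.\<close>

locale balanced_realization =
  fixes n m p r :: nat and A B C :: "nat \<Rightarrow> nat \<Rightarrow> real" and N :: "nat \<Rightarrow> nat \<Rightarrow> nat \<Rightarrow> real"
    and \<sigma> :: "nat \<Rightarrow> real" and Pg Ph :: "nat \<Rightarrow> nat \<Rightarrow> real"
  assumes r_le: "r \<le> n" and sigma_pos: "\<And>i. i < n \<Longrightarrow> 0 < \<sigma> i"
    and gram_P: "\<And>i j. i < n \<Longrightarrow> j < n \<Longrightarrow> A i j * \<sigma> j + \<sigma> i * A j i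
      + (\<Sum>k<m. \<Sum>l<n. N k i l * \<sigma> l * N k j l) = - (\<Sum>k<m. B i k * B j k)"
    and gram_Q: "\<And>i j. i < n \<Longrightarrow> j < n \<Longrightarrow> A j i * \<sigma> j + \<sigma> i * A i j
      + (\<Sum>k<m. \<Sum>l<n. N k l i * \<sigma> l * N k l j) = - (\<Sum>o'<p. C o' i * C o' j)"
    and Ph_eq: "\<And>i j. i < r \<Longrightarrow> j < r \<Longrightarrow> (\<Sum>l<r. A i l * Ph l j) + (\<Sum>l<r. Ph i l * A j l)
      + (\<Sum>k<m. \<Sum>l<r. \<Sum>q<r. N k i l * Ph l q * N k j q) = - (\<Sum>k<m. B i k * B j k)"
    and Pg_eq: "\<And>i j. i < n \<Longrightarrow> j < r \<Longrightarrow> (\<Sum>l<n. A i l * Pg l j) + (\<Sum>l<r. Pg i l * A j l)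
      + (\<Sum>k<m. \<Sum>l<n. \<Sum>q<r. N k i l * Pg l q * N k j q) = - (\<Sum>k<m. B i k * B j k)"
begin

definition I :: "(nat + nat) set" where "I = {..<n} <+> {..<r}"

fun ext_B :: "nat + nat \<Rightarrow> nat \<Rightarrow> real" where
  "ext_B (Inl i) k = B i k"
| "ext_B (Inr i) k = B i k"

text \<open>The minus sign makes the output of the stacked system the output error.\<close>

fun ext_C :: "nat \<Rightarrow> nat + nat \<Rightarrow> real" where
  "ext_C o' (Inl i) = C o' i"
| "ext_C o' (Inr i) = - C o' i"

text \<open>The error Gramian with blocks Sigma, \<open>Pg\<close>, the transpose of
  \<open>Pg\<close>, and \<open>Ph\<close>.\<close>

fun ext_P :: "nat + nat \<Rightarrow> nat + nat \<Rightarrow> real" where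
  "ext_P (Inl i) (Inl j) = (if i = j then \<sigma> i else 0)"
| "ext_P (Inl i) (Inr j) = Pg i j"
| "ext_P (Inr i) (Inl j) = Pg j i"
| "ext_P (Inr i) (Inr j) = Ph i j"

text \<open>The factor 2 pays for (a - b)^2 <= 2 a^2 + 2 b^2, which separates the full from the
  reduced output.\<close>

definition ext_S :: "nat + nat \<Rightarrow> nat + nat \<Rightarrow> real" where
  "ext_S = dup (\<lambda>i j. if i = j then 2 * \<sigma> i else 0)"

lemma finite_I: "finite I" by (simp add: I_def)

lemma sum_I: "(\<Sum>i\<in>I. f i) = (\<Sum>i<n. f (Inl i)) + (\<Sum>i<r. f (Inr i))"
  by (simp add: I_def sum.Plus)

lemma sum_split: "(\<Sum>i<n. f i) = (\<Sum>i<r. f i) + (\<Sum>i=r..<n. f i)" for f :: "nat \<Rightarrow> real"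
  using r_le by (metis atLeast0LessThan le0 sum.atLeastLessThan_concat)

text \<open>Block by block these are the defining equations of Sigma, of \<open>Pg\<close> (twice,
  once transposed) and of \<open>Ph\<close>.\<close>

lemma ext_lyap:
  assumes "x \<in> I" "y \<in> I"
  shows "lyap I m (dup A) (\<lambda>k. dup (N k)) ext_P x y = - (\<Sum>k<m. ext_B x k * ext_B y k)"
proof -
  consider i j where "x = Inl i" "y = Inl j" "i < n" "j < n"
    | i j where "x = Inl i" "y = Inr j" "i < n" "j < r"
    | i j where "x = Inr i" "y = Inl j" "i < r" "j < n"
    | i j where "x = Inr i" "y = Inr j" "i < r" "j < r"
    using assms by (auto simp: I_def)
  then show ?thesis
  proof cases
    case 1
    have "(\<Sum>l<n. A i l * (if l = j then \<sigma> l else 0)) = A i j * \<sigma> j"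
      "(\<Sum>l<n. (if i = l then \<sigma> i else 0) * A j l) = \<sigma> i * A j i"
      using 1 by (simp_all add: if_distrib[of "\<lambda>x. _ * x"] if_distrib[of "\<lambda>x. x * _"] cong: if_cong)
    moreover have "(\<Sum>q<n. N k i l * (if l = q then \<sigma> l else 0) * N k j q) = N k i l * \<sigma> l * N k j l"
      if "l < n" for k l
      using that by (simp add: if_distrib[of "\<lambda>x. _ * x"] if_distrib[of "\<lambda>x. x * _"] cong: if_cong)
    ultimately show ?thesis using gram_P[of i j] 1 by (simp add: lyap_def sum_I)
  next
    case 2
    then show ?thesis using Pg_eq[of i j] by (simp add: lyap_def sum_I)
  next
    case 3
    have "(\<Sum>l<r. \<Sum>q<n. N k i l * Pg q l * N k j q) = (\<Sum>l<n. \<Sum>q<r. N k j l * Pg l q * N k i q)" for k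
      by (subst sum.swap) (simp add: mult_ac)
    then show ?thesis using 3 Pg_eq[of j i] by (simp add: lyap_def sum_I mult.commute)
  next
    case 4
    then show ?thesis using Ph_eq[of i j] by (simp add: lyap_def sum_I)
  qed
qed

lemma ext_S_psd: "psd I ext_S"
proof -
  have "0 \<le> bform I ext_S v v" for v
  proof -
    have "(\<Sum>j<k. v (f i) * (if i = j then 2 * \<sigma> i else 0) * v (f j)) = 2 * \<sigma> i * (v (f i))\<^sup>2"
      if "i < k" for k i and f :: "nat \<Rightarrow> nat + nat"
      using that by (simp add: if_distrib[of "\<lambda>x. _ * x"] if_distrib[of "\<lambda>x. x * _"] power2_eq_square mult_ac cong: if_cong)
    then have "bform I ext_S v v = (\<Sum>i<n. 2 * \<sigma> i * (v (Inl i))\<^sup>2) + (\<Sum>i<r. 2 * \<sigma> i * (v (Inr i))\<^sup>2)"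
      by (simp add: bform_def sum_I ext_S_def)
    also have "\<dots> \<ge> 0"
      using sigma_pos r_le by (intro add_nonneg_nonneg sum_nonneg mult_nonneg_nonneg) (auto intro: less_imp_le)
    finally show ?thesis .
  qed
  then show ?thesis by (simp add: psd_def)
qed

text \<open>As Sigma is diagonal, the leading block of the dual equation involves A only through
  A_11. The one remnant of the truncation is N_21^T Sigma_2 N_21, so Sigma_1 satisfies the reduced
  dual equation up to a term of favourable sign.\<close>

lemma truncated_gram_Q:
  assumes "i < r" "j < r"
  shows "A j i * \<sigma> j + \<sigma> i * A i j + (\<Sum>k<m. \<Sum>l<r. N k l i * \<sigma> l * N k l j)
    = - (\<Sum>o'<p. C o' i * C o' j) - (\<Sum>k<m. \<Sum>l=r..<n. N k l i * \<sigma> l * N k l j)"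
  using gram_Q[of i j] assms r_le by (simp add: sum_split sum.distrib)

text \<open>\<open>ext_S\<close> is block diagonal and so is its image. The blocks yield minus twice
  the squared full and reduced outputs, the reduced one with a further nonpositive remainder from
  the truncation.\<close>

lemma ext_super:
  "bform I (adj_lyap I m (dup A) (\<lambda>k. dup (N k)) ext_S) v v \<le> - (\<Sum>o'<p. (\<Sum>i\<in>I. ext_C o' i * v i)\<^sup>2)"
proof -
  let ?L = "adj_lyap I m (dup A) (\<lambda>k. dup (N k)) ext_S"
  define vl where "vl i = v (Inl i)" for i
  define vr where "vr i = v (Inr i)" for i
  have diag: "(\<Sum>l<k. f l * (if l = j then 2 * \<sigma> l else 0)) = 2 * (f j * \<sigma> j)"
    "(\<Sum>l<k. (if j = l then 2 * \<sigma> j else 0) * f l) = 2 * (\<sigma> j * f j)"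
    "(\<Sum>q<k. g * (if j = q then 2 * \<sigma> j else 0) * f q) = 2 * (g * \<sigma> j * f j)"
    if "j < k" for j k g and f :: "nat \<Rightarrow> real"
    using that by (simp_all add: if_distrib[of "\<lambda>x. _ * x"] if_distrib[of "\<lambda>x. x * _"] cong: if_cong)
  have ll: "?L (Inl i) (Inl j) = - 2 * (\<Sum>o'<p. C o' i * C o' j)" if "i < n" "j < n" for i j
    using gram_Q[OF that] that by (simp add: adj_lyap_def sum_I ext_S_def diag sum_distrib_left[symmetric])
  have rr: "?L (Inr i) (Inr j) = - 2 * (\<Sum>o'<p. C o' i * C o' j)
      - 2 * (\<Sum>k<m. \<Sum>l=r..<n. N k l i * \<sigma> l * N k l j)" if "i < r" "j < r" for i j
    using truncated_gram_Q[OF that] that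
    by (simp add: adj_lyap_def sum_I ext_S_def diag sum_distrib_left[symmetric])
  have off: "?L (Inl i) (Inr j) = 0" "?L (Inr i) (Inl j) = 0" for i j
    by (simp_all add: adj_lyap_def sum_I ext_S_def)
  have "bform I ?L v v = bform {..<n} (\<lambda>i j. ?L (Inl i) (Inl j)) vl vl
      + bform {..<r} (\<lambda>i j. ?L (Inr i) (Inr j)) vr vr"
    by (simp add: bform_def sum_I off vl_def vr_def)
  also have "bform {..<n} (\<lambda>i j. ?L (Inl i) (Inl j)) vl vl
      = bform {..<n} (\<lambda>i j. (-2) * (\<Sum>o'<p. C o' i * C o' j) + 0 * 0) vl vl"
    by (rule bform_cong) (simp add: ll)
  also have "\<dots> = -2 * (\<Sum>o'<p. (\<Sum>i<n. C o' i * vl i)\<^sup>2)"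
    unfolding bform_linear bform_gram by simp
  also have "bform {..<r} (\<lambda>i j. ?L (Inr i) (Inr j)) vr vr
      = bform {..<r} (\<lambda>i j. (-2) * (\<Sum>o'<p. C o' i * C o' j)
         + (-2) * (\<Sum>k<m. \<Sum>l=r..<n. N k l i * \<sigma> l * N k l j)) vr vr"
    by (rule bform_cong) (simp add: rr)
  also have "\<dots> = -2 * (\<Sum>o'<p. (\<Sum>i<r. C o' i * vr i)\<^sup>2)
       - 2 * (\<Sum>k<m. \<Sum>l=r..<n. bform {..<r} (\<lambda>i j. N k l i * \<sigma> l * N k l j) vr vr)"
    unfolding bform_linear bform_gram bform_sum by simp
  finally have eq: "bform I ?L v v = -2 * (\<Sum>o'<p. (\<Sum>i<n. C o' i * vl i)\<^sup>2)
      + (-2 * (\<Sum>o'<p. (\<Sum>i<r. C o' i * vr i)\<^sup>2)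
       - 2 * (\<Sum>k<m. \<Sum>l=r..<n. bform {..<r} (\<lambda>i j. N k l i * \<sigma> l * N k l j) vr vr))" .
  have "0 \<le> (\<Sum>k<m. \<Sum>l=r..<n. bform {..<r} (\<lambda>i j. N k l i * \<sigma> l * N k l j) vr vr)"
  proof (intro sum_nonneg)
    fix k l assume "l \<in> {r..<n}"
    have "bform {..<r} (\<lambda>i j. N k l i * \<sigma> l * N k l j) vr vr = \<sigma> l * (\<Sum>i<r. N k l i * vr i)\<^sup>2"
      by (simp add: bform_def power2_eq_square sum_product sum_distrib_left mult_ac)
    also have "\<dots> \<ge> 0" using sigma_pos[of l] \<open>l \<in> {r..<n}\<close> by simp
    finally show "0 \<le> bform {..<r} (\<lambda>i j. N k l i * \<sigma> l * N k l j) vr vr" .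
  qed
  moreover have "(\<Sum>o'<p. (\<Sum>i\<in>I. ext_C o' i * v i)\<^sup>2)
      \<le> (\<Sum>o'<p. 2 * (\<Sum>i<n. C o' i * vl i)\<^sup>2 + 2 * (\<Sum>i<r. C o' i * vr i)\<^sup>2)"
  proof (rule sum_mono)
    fix o'
    have "(\<Sum>i\<in>I. ext_C o' i * v i) = (\<Sum>i<n. C o' i * vl i) - (\<Sum>i<r. C o' i * vr i)"
      by (simp add: sum_I vl_def vr_def sum_negf)
    moreover have "(\<alpha> - \<beta>)\<^sup>2 \<le> 2 * \<alpha>\<^sup>2 + 2 * \<beta>\<^sup>2" for \<alpha> \<beta> :: real
      using zero_le_power2[of "\<alpha> + \<beta>"] by (simp add: power2_eq_square algebra_simps)
    ultimately show "(\<Sum>i\<in>I. ext_C o' i * v i)\<^sup>2 \<le> 2 * (\<Sum>i<n. C o' i * vl i)\<^sup>2 + 2 * (\<Sum>i<r. C o' i * vr i)\<^sup>2"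
      by simp
  qed
  ultimately show ?thesis unfolding eq by (simp add: sum.distrib sum_distrib_left[symmetric])
qed

text \<open>C^T C is eliminated by the dual Gramian equation, after which the equations of Sigma,
  \<open>Pg\<close> and \<open>Ph\<close> bring in B B^T. In full - 2 cross + reduced the B terms
  with index below r carry the weights 1 - 2 + 1 = 0, so only indices from r on remain, which is the
  diagonal of Sigma_2 K_BT.\<close>

lemma pairing_trace:
  "(\<Sum>x\<in>I. \<Sum>y\<in>I. ext_P x y * (\<Sum>o'<p. ext_C o' x * ext_C o' y)) =
    (\<Sum>i=r..<n. \<sigma> i * ((\<Sum>k<m. B i k * B i k) + 2 * (\<Sum>l<r. Pg i l * A i l)
      + (\<Sum>k<m. 2 * (\<Sum>l<n. \<Sum>q<r. N k i l * Pg l q * N k i q) - (\<Sum>l<r. \<Sum>q<r. N k i l * Ph l q * N k i q))))"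
proof -
  define CC where "CC i j = (\<Sum>o'<p. C o' i * C o' j)" for i j
  define BB where "BB i = (\<Sum>k<m. B i k * B i k)" for i
  define V where "V i = (\<Sum>l<r. Pg i l * A i l)" for i
  define W where "W i = (\<Sum>k<m. \<Sum>l<n. \<Sum>q<r. N k i l * Pg l q * N k i q)" for i
  define Wh where "Wh i = (\<Sum>k<m. \<Sum>l<r. \<Sum>q<r. N k i l * Ph l q * N k i q)" for i
  have CC: "CC i j = - (A j i * \<sigma> j) - \<sigma> i * A i j - (\<Sum>k<m. \<Sum>l<n. N k l i * \<sigma> l * N k l j)"
    if "i < n" "j < n" for i j
    using gram_Q[OF that] by (simp add: CC_def)
  have CC_sym: "CC i j = CC j i" for i j by (simp add: CC_def mult.commute)
  \<comment> \<open>Moves the N_k from the diagonal weight onto F, for rectangular leading blocks,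
    so that the N terms of the dual equation turn into those of the primal ones.\<close>
  have weighted: "(\<Sum>i<a. \<Sum>j<b. F i j * (\<Sum>k<m. \<Sum>l<n. N k l i * \<sigma> l * N k l j))
      = (\<Sum>l<n. \<sigma> l * (\<Sum>k<m. \<Sum>i<a. \<Sum>j<b. N k l i * F i j * N k l j))" for F :: "nat \<Rightarrow> nat \<Rightarrow> real" and a b :: nat
  proof -
    have "(\<Sum>i<a. \<Sum>j<b. F i j * (\<Sum>k<m. \<Sum>l<n. N k l i * \<sigma> l * N k l j))
        = (\<Sum>i<a. \<Sum>j<b. \<Sum>k<m. \<Sum>l<n. \<sigma> l * (N k l i * F i j * N k l j))"
      by (simp add: sum_distrib_left mult_ac)
    also have "\<dots> = (\<Sum>k<m. \<Sum>l<n. \<Sum>i<a. \<Sum>j<b. \<sigma> l * (N k l i * F i j * N k l j))"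
      by (rule sum_swap_pairs)
    also have "\<dots> = (\<Sum>l<n. \<Sum>k<m. \<Sum>i<a. \<Sum>j<b. \<sigma> l * (N k l i * F i j * N k l j))"
      by (rule sum.swap)
    finally show ?thesis by (simp add: sum_distrib_left)
  qed
  \<comment> \<open>tr (Sigma C^T C) = tr (Sigma B B^T), because Sigma solves both Gramian
    equations.\<close>
  have full: "(\<Sum>i<n. \<sigma> i * CC i i) = (\<Sum>i<n. \<sigma> i * BB i)"
  proof -
    have "(\<Sum>i<n. \<sigma> i * CC i i) = (\<Sum>i<n. \<sigma> i * (- (A i i * \<sigma> i) - \<sigma> i * A i i
        - (\<Sum>k<m. \<Sum>l<n. N k l i * \<sigma> l * N k l i)))"
      by (intro sum.cong refl) (simp only: CC lessThan_iff)
    also have "\<dots> = - 2 * (\<Sum>i<n. \<sigma> i * A i i * \<sigma> i)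
        - (\<Sum>i<n. \<sigma> i * (\<Sum>k<m. \<Sum>l<n. N k l i * \<sigma> l * N k l i))"
      by (simp add: sum_subtractf sum_distrib_left right_diff_distrib sum_negf mult_ac)
    also have "(\<Sum>i<n. \<sigma> i * (\<Sum>k<m. \<Sum>l<n. N k l i * \<sigma> l * N k l i))
        = (\<Sum>i<n. \<sigma> i * (\<Sum>k<m. \<Sum>l<n. N k i l * \<sigma> l * N k i l))"
    proof -
      have "(\<Sum>i<n. \<Sum>k<m. \<Sum>l<n. \<sigma> i * (N k l i * \<sigma> l * N k l i))
          = (\<Sum>k<m. \<Sum>i<n. \<Sum>l<n. \<sigma> i * (N k l i * \<sigma> l * N k l i))" by (rule sum.swap)
      also have "\<dots> = (\<Sum>k<m. \<Sum>l<n. \<Sum>i<n. \<sigma> i * (N k l i * \<sigma> l * N k l i))"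
        by (rule sum.cong[OF refl], rule sum.swap)
      also have "\<dots> = (\<Sum>l<n. \<Sum>k<m. \<Sum>i<n. \<sigma> i * (N k l i * \<sigma> l * N k l i))" by (rule sum.swap)
      finally show ?thesis by (simp add: sum_distrib_left mult_ac)
    qed
    also have "- 2 * (\<Sum>i<n. \<sigma> i * A i i * \<sigma> i) - (\<Sum>i<n. \<sigma> i * (\<Sum>k<m. \<Sum>l<n. N k i l * \<sigma> l * N k i l))
        = (\<Sum>i<n. \<sigma> i * (- (A i i * \<sigma> i + \<sigma> i * A i i + (\<Sum>k<m. \<Sum>l<n. N k i l * \<sigma> l * N k i l))))"
      by (simp add: distrib_left sum.distrib sum_distrib_left sum_negf sum_subtractf right_diff_distrib mult_ac)
    also have "\<dots> = (\<Sum>i<n. \<sigma> i * BB i)"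
      by (intro sum.cong refl) (simp only: gram_P BB_def lessThan_iff minus_minus)
    finally show ?thesis .
  qed
  \<comment> \<open>X is rewritten by the equation of \<open>Pg\<close> at (j,j) with j < r, which
    cancels the V and W contributions below r.\<close>
  have cross: "(\<Sum>i<n. \<Sum>j<r. Pg i j * CC i j)
      = (\<Sum>i<r. \<sigma> i * BB i) - (\<Sum>i=r..<n. \<sigma> i * V i) - (\<Sum>i=r..<n. \<sigma> i * W i)"
  proof -
    define X where "X = (\<Sum>i<n. \<Sum>j<r. Pg i j * (A j i * \<sigma> j))"
    have "(\<Sum>i<n. \<Sum>j<r. Pg i j * CC i j) = (\<Sum>i<n. \<Sum>j<r. - (Pg i j * (A j i * \<sigma> j)) - Pg i j * (\<sigma> i * A i j)
        - Pg i j * (\<Sum>k<m. \<Sum>l<n. N k l i * \<sigma> l * N k l j))"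
      using r_le by (intro sum.cong refl) (simp add: CC right_diff_distrib)
    also have "\<dots> = - X - (\<Sum>i<n. \<sigma> i * V i) - (\<Sum>l<n. \<sigma> l * W l)"
      unfolding sum_subtractf sum_negf weighted X_def W_def V_def
      by (simp add: sum_distrib_left mult_ac)
    finally have 1: "(\<Sum>i<n. \<Sum>j<r. Pg i j * CC i j) = - X - (\<Sum>i<n. \<sigma> i * V i) - (\<Sum>l<n. \<sigma> l * W l)" .
    have "X = (\<Sum>j<r. \<sigma> j * (\<Sum>l<n. A j l * Pg l j))"
      unfolding X_def by (subst sum.swap) (simp add: sum_distrib_left mult_ac)
    also have "\<dots> = (\<Sum>j<r. \<sigma> j * (- BB j - V j - W j))"
    proof (intro sum.cong refl)
      fix j assume "j \<in> {..<r}"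
      then have "(\<Sum>l<n. A j l * Pg l j) = - BB j - V j - W j"
        using Pg_eq[of j j] r_le by (simp add: BB_def V_def W_def)
      then show "\<sigma> j * (\<Sum>l<n. A j l * Pg l j) = \<sigma> j * (- BB j - V j - W j)" by simp
    qed
    finally show ?thesis
      unfolding 1 by (simp add: sum_split right_diff_distrib sum_subtractf sum_negf)
  qed
  \<comment> \<open>Here also the second drift term X2 cancels completely. Only the N terms leave a
    remainder, since in the dual equation their inner index runs up to n and in the equation of
    \<open>Ph\<close> only up to r.\<close>
  have reduced: "(\<Sum>i<r. \<Sum>j<r. Ph i j * CC i j) = (\<Sum>i<r. \<sigma> i * BB i) - (\<Sum>i=r..<n. \<sigma> i * Wh i)"
  proof -
    define X where "X = (\<Sum>i<r. \<Sum>j<r. Ph i j * (A j i * \<sigma> j))"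
    define X2 where "X2 = (\<Sum>i<r. \<sigma> i * (\<Sum>l<r. Ph i l * A i l))"
    have "(\<Sum>i<r. \<Sum>j<r. Ph i j * CC i j) = (\<Sum>i<r. \<Sum>j<r. - (Ph i j * (A j i * \<sigma> j)) - Ph i j * (\<sigma> i * A i j)
        - Ph i j * (\<Sum>k<m. \<Sum>l<n. N k l i * \<sigma> l * N k l j))"
      using r_le by (intro sum.cong refl) (simp add: CC right_diff_distrib)
    also have "\<dots> = - X - X2 - (\<Sum>l<n. \<sigma> l * Wh l)"
      unfolding sum_subtractf sum_negf weighted X_def Wh_def X2_def
      by (simp add: sum_distrib_left mult_ac)
    finally have 1: "(\<Sum>i<r. \<Sum>j<r. Ph i j * CC i j) = - X - X2 - (\<Sum>l<n. \<sigma> l * Wh l)" .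
    have "X = (\<Sum>j<r. \<sigma> j * (\<Sum>l<r. A j l * Ph l j))"
      unfolding X_def by (subst sum.swap) (simp add: sum_distrib_left mult_ac)
    also have "\<dots> = (\<Sum>j<r. \<sigma> j * (- BB j - (\<Sum>l<r. Ph j l * A j l) - Wh j))"
    proof (intro sum.cong refl)
      fix j assume "j \<in> {..<r}"
      then have "(\<Sum>l<r. A j l * Ph l j) = - BB j - (\<Sum>l<r. Ph j l * A j l) - Wh j"
        using Ph_eq[of j j] by (simp add: BB_def Wh_def)
      then show "\<sigma> j * (\<Sum>l<r. A j l * Ph l j) = \<sigma> j * (- BB j - (\<Sum>l<r. Ph j l * A j l) - Wh j)" by simp
    qed
    also have "\<dots> = - (\<Sum>j<r. \<sigma> j * BB j) - X2 - (\<Sum>j<r. \<sigma> j * Wh j)"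
      by (simp add: X2_def right_diff_distrib sum_subtractf sum_negf)
    finally show ?thesis unfolding 1 by (simp add: sum_split)
  qed
  have CC_ext: "(\<Sum>o'<p. ext_C o' (Inl i) * ext_C o' (Inl j)) = CC i j"
    "(\<Sum>o'<p. ext_C o' (Inl i) * ext_C o' (Inr j)) = - CC i j"
    "(\<Sum>o'<p. ext_C o' (Inr i) * ext_C o' (Inl j)) = - CC i j"
    "(\<Sum>o'<p. ext_C o' (Inr i) * ext_C o' (Inr j)) = CC i j" for i j
    by (simp_all add: CC_def sum_negf)
  have "(\<Sum>x\<in>I. \<Sum>y\<in>I. ext_P x y * (\<Sum>o'<p. ext_C o' x * ext_C o' y)) =
      (\<Sum>i<n. \<Sum>j<n. (if i = j then \<sigma> i else 0) * CC i j) + (\<Sum>i<n. \<Sum>j<r. Pg i j * - CC i j)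
      + ((\<Sum>i<r. \<Sum>j<n. Pg j i * - CC i j) + (\<Sum>i<r. \<Sum>j<r. Ph i j * CC i j))"
    unfolding sum_I CC_ext ext_P.simps sum.distrib by (simp only: add_ac)
  also have "(\<Sum>i<r. \<Sum>j<n. Pg j i * - CC i j) = (\<Sum>i<n. \<Sum>j<r. Pg i j * - CC i j)"
    by (subst sum.swap) (simp add: CC_sym)
  also have "(\<Sum>i<n. \<Sum>j<r. Pg i j * - CC i j) = - (\<Sum>i<n. \<Sum>j<r. Pg i j * CC i j)"
    by (simp add: sum_negf)
  also have "(\<Sum>i<n. \<Sum>j<n. (if i = j then \<sigma> i else 0) * CC i j) = (\<Sum>i<n. \<sigma> i * CC i i)"
    by (simp add: if_distrib[of "\<lambda>x. x * _"] cong: if_cong)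
  finally have "(\<Sum>x\<in>I. \<Sum>y\<in>I. ext_P x y * (\<Sum>o'<p. ext_C o' x * ext_C o' y)) =
      (\<Sum>i=r..<n. \<sigma> i * BB i) + 2 * (\<Sum>i=r..<n. \<sigma> i * V i) + 2 * (\<Sum>i=r..<n. \<sigma> i * W i) - (\<Sum>i=r..<n. \<sigma> i * Wh i)"
    unfolding full cross reduced by (simp add: sum_split)
  also have "\<dots> = (\<Sum>i=r..<n. \<sigma> i * (BB i + 2 * V i + (2 * W i - Wh i)))"
    by (simp add: algebra_simps sum.distrib sum_subtractf sum_distrib_left)
  finally show ?thesis
    by (simp add: BB_def V_def W_def Wh_def sum_subtractf sum_distrib_left[symmetric])
qed

end

subsection \<open>The error bound\<close>


lemma index_mult_mat_sum:
  fixes X Z :: "real mat"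
  assumes "X \<in> carrier_mat a b" "Z \<in> carrier_mat b c" "i < a" "j < c"
  shows "(X * Z) $$ (i,j) = (\<Sum>l<b. X $$ (i,l) * Z $$ (l,j))"
  using assms by (simp add: scalar_prod_def atLeast0LessThan)

lemma index_mult_mat3_sum:
  fixes X P Z :: "real mat"
  assumes "X \<in> carrier_mat a b" "P \<in> carrier_mat b c" "Z \<in> carrier_mat c d" "i < a" "j < d"
  shows "(X * P * Z) $$ (i,j) = (\<Sum>l<b. \<Sum>q<c. X $$ (i,l) * P $$ (l,q) * Z $$ (q,j))"
proof -
  have "(X * P * Z) $$ (i,j) = (\<Sum>q<c. (X * P) $$ (i,q) * Z $$ (q,j))"
    using assms by (intro index_mult_mat_sum) auto
  also have "\<dots> = (\<Sum>q<c. (\<Sum>l<b. X $$ (i,l) * P $$ (l,q)) * Z $$ (q,j))"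
    using assms by (intro sum.cong refl) (simp add: index_mult_mat_sum[OF assms(1,2)] del: index_mult_mat)
  also have "\<dots> = (\<Sum>l<b. \<Sum>q<c. X $$ (i,l) * P $$ (l,q) * Z $$ (q,j))"
    by (subst sum.swap) (simp add: sum_distrib_right)
  finally show ?thesis .
qed

lemma index_mult_vec_sum:
  fixes X :: "real mat"
  assumes "X \<in> carrier_mat a b" "v \<in> carrier_vec b" "i < a"
  shows "(X *\<^sub>v v) $ i = (\<Sum>j<b. X $$ (i,j) * v $ j)"
  using assms by (simp add: scalar_prod_def atLeast0LessThan)

text \<open>Two possibly different systems are allowed, so that the equations of \<open>Pg\<close>,
  of \<open>Phat\<close> and of the diagonal Gramians are all instances.\<close>

lemma sylvester_entry:
  assumes A: "A \<in> carrier_mat n n" "A' \<in> carrier_mat r r" and P: "P \<in> carrier_mat n r"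
    and N: "\<forall>k<m. N k \<in> carrier_mat n n" "\<forall>k<m. N' k \<in> carrier_mat r r"
    and B: "B \<in> carrier_mat n b" "B' \<in> carrier_mat r b"
    and eq: "A * P + P * A'\<^sup>T + msum n r (\<lambda>k. N k * P * (N' k)\<^sup>T) m = - (B * B'\<^sup>T)"
    and ij: "i < n" "j < r"
  shows "(\<Sum>l<n. A $$ (i,l) * P $$ (l,j)) + (\<Sum>l<r. P $$ (i,l) * A' $$ (j,l))
      + (\<Sum>k<m. \<Sum>l<n. \<Sum>q<r. N k $$ (i,l) * P $$ (l,q) * N' k $$ (j,q))
    = - (\<Sum>k<b. B $$ (i,k) * B' $$ (j,k))"
proof -
  have "(A * P + P * A'\<^sup>T + msum n r (\<lambda>k. N k * P * (N' k)\<^sup>T) m) $$ (i,j)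
      = (A * P) $$ (i,j) + (P * A'\<^sup>T) $$ (i,j) + (\<Sum>k<m. (N k * P * (N' k)\<^sup>T) $$ (i,j))"
    using A P N ij by (simp add: msum_def del: index_mult_mat(1))
  moreover have "(A * P) $$ (i,j) = (\<Sum>l<n. A $$ (i,l) * P $$ (l,j))"
    by (rule index_mult_mat_sum[OF A(1) P ij])
  moreover have "(P * A'\<^sup>T) $$ (i,j) = (\<Sum>l<r. P $$ (i,l) * A' $$ (j,l))"
    using index_mult_mat_sum[OF P, of "A'\<^sup>T" r i j] A ij by (simp del: index_mult_mat(1))
  moreover have "(N k * P * (N' k)\<^sup>T) $$ (i,j) = (\<Sum>l<n. \<Sum>q<r. N k $$ (i,l) * P $$ (l,q) * N' k $$ (j,q))"
    if "k < m" for k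
  proof -
    have Nk: "N k \<in> carrier_mat n n" "N' k \<in> carrier_mat r r" using N that by auto
    then show ?thesis
      using index_mult_mat3_sum[of "N k" n n P r "(N' k)\<^sup>T" r i j] P ij by (simp del: index_mult_mat(1))
  qed
  moreover have "(- (B * B'\<^sup>T)) $$ (i,j) = - (\<Sum>k<b. B $$ (i,k) * B' $$ (j,k))"
    using index_mult_mat_sum[of B n b "B'\<^sup>T" r i j] B ij by (simp del: index_mult_mat(1))
  ultimately show ?thesis using eq by simp
qed

lemma index_mat_diag: "i < n \<Longrightarrow> j < n \<Longrightarrow> mat_diag n f $$ (i,j) = (if i = j then f j else 0)"
  by (simp add: mat_diag_def)

lemma diagonal_gramian_entry:
  assumes A: "A \<in> carrier_mat n n" and N: "\<forall>k<m. N k \<in> carrier_mat n n" and B: "B \<in> carrier_mat n b"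
    and eq: "A * mat_diag n \<sigma> + mat_diag n \<sigma> * A\<^sup>T + msum n n (\<lambda>k. N k * mat_diag n \<sigma> * (N k)\<^sup>T) m = - (B * B\<^sup>T)"
    and ij: "i < n" "j < n"
  shows "A $$ (i,j) * \<sigma> j + \<sigma> i * A $$ (j,i) + (\<Sum>k<m. \<Sum>l<n. N k $$ (i,l) * \<sigma> l * N k $$ (j,l))
    = - (\<Sum>k<b. B $$ (i,k) * B $$ (j,k))"
proof -
  have 1: "(\<Sum>l<n. A $$ (i,l) * mat_diag n \<sigma> $$ (l,j)) = (\<Sum>l<n. if l = j then A $$ (i,l) * \<sigma> l else 0)"
    using ij by (intro sum.cong refl) (simp add: index_mat_diag)
  have 2: "(\<Sum>l<n. mat_diag n \<sigma> $$ (i,l) * A $$ (j,l)) = (\<Sum>l<n. if l = i then \<sigma> l * A $$ (j,l) else 0)"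
    using ij by (intro sum.cong refl) (simp add: index_mat_diag)
  have 3: "(\<Sum>l<n. \<Sum>q<n. N k $$ (i,l) * mat_diag n \<sigma> $$ (l,q) * N k $$ (j,q))
      = (\<Sum>l<n. \<Sum>q<n. if q = l then N k $$ (i,l) * \<sigma> q * N k $$ (j,q) else 0)" for k
    by (intro sum.cong refl) (simp add: index_mat_diag)
  show ?thesis
    using sylvester_entry[OF A A mat_diag_dim N N B B eq ij] ij unfolding 1 2 3 by simp
qed

lemma blk_carrier [simp]: "blk M a b c d \<in> carrier_mat c d"
  by (simp add: blk_def)

lemma index_blk [simp]: "i < c \<Longrightarrow> j < d \<Longrightarrow> blk M a b c d $$ (i,j) = M $$ (a + i, b + j)"
  by (simp add: blk_def)

lemma mtrace_mat_diag_mult: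
  assumes "M \<in> carrier_mat n n"
  shows "mtrace (mat_diag n f * M) = (\<Sum>i<n. f i * M $$ (i,i))"
  using assms by (simp add: mat_diag_mult_left mtrace_def)

theorem theorem5p1:
  fixes n m p r :: nat
    and A :: "real mat" and B :: "real mat" and C :: "real mat" and N :: "nat \<Rightarrow> real mat"
    and \<sigma> :: "nat \<Rightarrow> real" and Phat :: "real mat" and Pg :: "real mat"
    and Ah Bh Ch :: "real mat" and Nh :: "nat \<Rightarrow> real mat"
    and u x xh :: "real \<Rightarrow> real vec"
  assumes dims: "A \<in> carrier_mat n n" "B \<in> carrier_mat n m" "C \<in> carrier_mat p n"
      "\<forall>k<m. N k \<in> carrier_mat n n"
    and r_le: "r \<le> n"
    and stab: "spec_in_lhp (kron A (1\<^sub>m n) + kron (1\<^sub>m n) A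
                 + msum (n*n) (n*n) (\<lambda>k. kron (N k) (N k)) m)"
    and sigma_pos: "\<forall>i<n. \<sigma> i > 0"
    and gram_P: "A * mat_diag n \<sigma> + mat_diag n \<sigma> * A\<^sup>T
                 + msum n n (\<lambda>k. N k * mat_diag n \<sigma> * (N k)\<^sup>T) m = - (B * B\<^sup>T)"
    and gram_Q: "A\<^sup>T * mat_diag n \<sigma> + mat_diag n \<sigma> * A
                 + msum n n (\<lambda>k. (N k)\<^sup>T * mat_diag n \<sigma> * N k) m = - (C\<^sup>T * C)"
    and Ah_def: "Ah = blk A 0 0 r r" and Bh_def: "Bh = blk B 0 0 r m"
    and Ch_def: "Ch = blk C 0 0 p r" and Nh_def: "\<forall>k. Nh k = blk (N k) 0 0 r r"
    and Phat_dim: "Phat \<in> carrier_mat r r"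
    and Phat_eq: "Ah * Phat + Phat * Ah\<^sup>T + msum r r (\<lambda>k. Nh k * Phat * (Nh k)\<^sup>T) m = - (Bh * Bh\<^sup>T)"
    and Pg_dim: "Pg \<in> carrier_mat n r"
    and Pg_eq: "A * Pg + Pg * Ah\<^sup>T + msum n r (\<lambda>k. N k * Pg * (Nh k)\<^sup>T) m = - (B * Bh\<^sup>T)"
    and u_L2: "is_L2_input m u"
    and x_sol: "bilin_sol A B N m u x"
    and xh_sol: "bilin_sol Ah Bh Nh m u xh"
  shows "\<forall>t\<ge>0. vnorm2 (C *\<^sub>v x t - Ch *\<^sub>v xh t) \<le>
     sqrt (mtrace (mat_diag (n - r) (\<lambda>i. \<sigma> (r + i)) *
        (blk B r 0 (n - r) m * (blk B r 0 (n - r) m)\<^sup>T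
         + 2 \<cdot>\<^sub>m (blk Pg r 0 (n - r) r * (blk A r 0 (n - r) r)\<^sup>T)
         + msum (n - r) (n - r) (\<lambda>k.
               2 \<cdot>\<^sub>m (blk (N k) r r (n - r) (n - r) * blk Pg r 0 (n - r) r * (blk (N k) r 0 (n - r) r)\<^sup>T)
             + 2 \<cdot>\<^sub>m (blk (N k) r 0 (n - r) r * blk Pg 0 0 r r * (blk (N k) r 0 (n - r) r)\<^sup>T)
             - blk (N k) r 0 (n - r) r * Phat * (blk (N k) r 0 (n - r) r)\<^sup>T) m)))
     * exp (0.5 * L2sq m (\<lambda>k. N k \<noteq> 0\<^sub>m n n) u)
     * sqrt (L2sq m (\<lambda>k. True) u)"
proof (intro allI impI)
  fix T :: real assume T: "0 \<le> T"
  interpret balanced_realization n m p r "\<lambda>i j. A $$ (i,j)" "\<lambda>i j. B $$ (i,j)" "\<lambda>i j. C $$ (i,j)"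
    "\<lambda>k i j. N k $$ (i,j)" \<sigma> "\<lambda>i j. Pg $$ (i,j)" "\<lambda>i j. Phat $$ (i,j)"
  proof
    show "r \<le> n" by (rule r_le)
    show "0 < \<sigma> i" if "i < n" for i using sigma_pos that by simp
    fix i j
    show "A $$ (i,j) * \<sigma> j + \<sigma> i * A $$ (j,i) + (\<Sum>k<m. \<Sum>l<n. N k $$ (i,l) * \<sigma> l * N k $$ (j,l))
        = - (\<Sum>k<m. B $$ (i,k) * B $$ (j,k))" if "i < n" "j < n"
      by (rule diagonal_gramian_entry[OF dims(1,4,2) gram_P that])
    show "A $$ (j,i) * \<sigma> j + \<sigma> i * A $$ (i,j) + (\<Sum>k<m. \<Sum>l<n. N k $$ (l,i) * \<sigma> l * N k $$ (l,j))
        = - (\<Sum>o'<p. C $$ (o',i) * C $$ (o',j))" if ij: "i < n" "j < n"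
    proof -
      \<comment> \<open>The dual equation is the primal one for the transposed data, with C^T in the
        place of B.\<close>
      have Nt: "\<forall>k<m. (N k)\<^sup>T \<in> carrier_mat n n" using dims(4) by simp
      have "A\<^sup>T $$ (i,j) * \<sigma> j + \<sigma> i * A\<^sup>T $$ (j,i) + (\<Sum>k<m. \<Sum>l<n. (N k)\<^sup>T $$ (i,l) * \<sigma> l * (N k)\<^sup>T $$ (j,l))
        = - (\<Sum>o'<p. C\<^sup>T $$ (i,o') * C\<^sup>T $$ (j,o'))"
        using dims gram_Q by (intro diagonal_gramian_entry[OF _ Nt _ _ ij]) simp_all
      moreover have "(\<Sum>k<m. \<Sum>l<n. (N k)\<^sup>T $$ (i,l) * \<sigma> l * (N k)\<^sup>T $$ (j,l))
          = (\<Sum>k<m. \<Sum>l<n. N k $$ (l,i) * \<sigma> l * N k $$ (l,j))"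
        using dims(4) ij by (intro sum.cong refl) auto
      moreover have "(\<Sum>o'<p. C\<^sup>T $$ (i,o') * C\<^sup>T $$ (j,o')) = (\<Sum>o'<p. C $$ (o',i) * C $$ (o',j))"
        using dims(3) ij by (intro sum.cong refl) auto
      ultimately show ?thesis using dims(1) ij by simp
    qed
    show "(\<Sum>l<r. A $$ (i,l) * Phat $$ (l,j)) + (\<Sum>l<r. Phat $$ (i,l) * A $$ (j,l))
      + (\<Sum>k<m. \<Sum>l<r. \<Sum>q<r. N k $$ (i,l) * Phat $$ (l,q) * N k $$ (j,q))
      = - (\<Sum>k<m. B $$ (i,k) * B $$ (j,k))" if "i < r" "j < r"
      using sylvester_entry[of Ah r Ah r Phat m Nh Nh Bh m Bh i j] Phat_dim Phat_eq that
      by (simp add: Ah_def Bh_def Nh_def)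
    show "(\<Sum>l<n. A $$ (i,l) * Pg $$ (l,j)) + (\<Sum>l<r. Pg $$ (i,l) * A $$ (j,l))
      + (\<Sum>k<m. \<Sum>l<n. \<Sum>q<r. N k $$ (i,l) * Pg $$ (l,q) * N k $$ (j,q))
      = - (\<Sum>k<m. B $$ (i,k) * B $$ (j,k))" if "i < n" "j < r"
      using sylvester_entry[of A n Ah r Pg m N Nh B m Bh i j] dims Pg_dim Pg_eq that
      by (simp add: Ah_def Bh_def Nh_def)
  qed

  \<comment> \<open>The error system along the given trajectories\<close>
  define K where "K = {k. k < m \<and> N k \<noteq> 0\<^sub>m n n}"
  define w where "w s k = u s $ k" for s k
  define z where "z s = case_sum (\<lambda>i. x s $ i) (\<lambda>i. xh s $ i)" for s
  have x_dim: "x s \<in> carrier_vec n" and xh_dim: "xh s \<in> carrier_vec r" and u_dim: "u s \<in> carrier_vec m"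
    if "s \<ge> 0" for s
    using x_sol xh_sol u_L2 dims that by (auto simp: bilin_sol_def is_L2_input_def Ah_def blk_def)
  have usq: "(\<lambda>s. (w s k)\<^sup>2) absolutely_integrable_on {0..}" if "k < m" for k
    using u_L2 that by (intro nonnegative_absolutely_integrable_1) (auto simp: is_L2_input_def w_def)
  have usq_T: "(\<lambda>s. (w s k)\<^sup>2) absolutely_integrable_on {0..T}" if "k < m" for k
    by (rule absolutely_integrable_on_subinterval[OF usq[OF that]]) auto
  \<comment> \<open>On a bounded interval a square integrable control is integrable, being dominated
    by 1 plus its square.\<close>
  have u_abs: "(\<lambda>s. w s k) absolutely_integrable_on {0..T}" if "k < m" for k
  proof (rule measurable_bounded_by_integrable_imp_absolutely_integrable)
    have "(\<lambda>s. w s k) \<in> borel_measurable (lebesgue_on {0..})"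
      using u_L2 that by (intro measurable_on_imp_borel_measurable_lebesgue) (auto simp: is_L2_input_def w_def)
    then show "(\<lambda>s. w s k) \<in> borel_measurable (lebesgue_on {0..T})"
      by (rule measurable_restrict_mono) auto
    show "(\<lambda>s. 1 + (w s k)\<^sup>2) integrable_on {0..T}"
      using set_lebesgue_integral_eq_integral(1)[OF usq_T[OF that]] by (intro integrable_add) auto
    fix s
    show "norm (w s k) \<le> 1 + (w s k)\<^sup>2"
      \<comment> \<open>This square gives |w| <= w^2 + 1/4.\<close>
      using zero_le_power2[of "\<bar>w s k\<bar> - 1/2"] by (simp add: power2_diff power2_eq_square field_simps)
  qed simp
  have mvec_Inl: "mvec I (dup M) (z s) (Inl i) = (\<Sum>j<n. M i j * x s $ j)"
    and mvec_Inr: "mvec I (dup M) (z s) (Inr i) = (\<Sum>j<r. M i j * xh s $ j)" for M s i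
    by (simp_all add: mvec_def sum_I z_def)
  have sol: "((\<lambda>s. mvec I (dup (\<lambda>i j. A $$ (i,j))) (z s) e + (\<Sum>k<m. w s k * ext_B e k)
      + (\<Sum>k<m. w s k * mvec I (dup (\<lambda>i j. N k $$ (i,j))) (z s) e)) has_integral z t e) {0..t}"
    if e: "e \<in> I" and t: "t \<in> {0..T}" for e t
  proof (cases e)
    case (Inl i)
    with e have i: "i < n" by (auto simp: I_def)
    have "((\<lambda>s. (A *\<^sub>v x s) $ i + (B *\<^sub>v u s) $ i + (\<Sum>k<m. u s $ k * (N k *\<^sub>v x s) $ i))
          has_integral (x t $ i)) {0..t}"
      using x_sol i t dims(1) by (auto simp: bilin_sol_def)
    moreover have "(A *\<^sub>v x s) $ i + (B *\<^sub>v u s) $ i + (\<Sum>k<m. u s $ k * (N k *\<^sub>v x s) $ i)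
        = mvec I (dup (\<lambda>i j. A $$ (i,j))) (z s) e + (\<Sum>k<m. w s k * ext_B e k)
          + (\<Sum>k<m. w s k * mvec I (dup (\<lambda>i j. N k $$ (i,j))) (z s) e)" if "s \<in> {0..t}" for s
    proof -
      have s: "s \<ge> 0" using that by simp
      have "(N k *\<^sub>v x s) $ i = (\<Sum>j<n. N k $$ (i,j) * x s $ j)" if "k < m" for k
        using dims(4) that by (intro index_mult_vec_sum[OF _ x_dim[OF s] i]) auto
      then show ?thesis
        unfolding Inl mvec_Inl
        by (simp add: index_mult_vec_sum[OF dims(1) x_dim[OF s] i] index_mult_vec_sum[OF dims(2) u_dim[OF s] i]
            w_def mult.commute del: index_mult_mat_vec)
    qed
    ultimately show ?thesis by (subst has_integral_cong[symmetric]) (auto simp: Inl z_def)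
  next
    case (Inr i)
    with e have i: "i < r" by (auto simp: I_def)
    have "((\<lambda>s. (Ah *\<^sub>v xh s) $ i + (Bh *\<^sub>v u s) $ i + (\<Sum>k<m. u s $ k * (Nh k *\<^sub>v xh s) $ i))
          has_integral (xh t $ i)) {0..t}"
      using xh_sol i t by (auto simp: bilin_sol_def Ah_def blk_def)
    moreover have "(Ah *\<^sub>v xh s) $ i + (Bh *\<^sub>v u s) $ i + (\<Sum>k<m. u s $ k * (Nh k *\<^sub>v xh s) $ i)
        = mvec I (dup (\<lambda>i j. A $$ (i,j))) (z s) e + (\<Sum>k<m. w s k * ext_B e k)
          + (\<Sum>k<m. w s k * mvec I (dup (\<lambda>i j. N k $$ (i,j))) (z s) e)" if "s \<in> {0..t}" for s
    proof -
      have s: "s \<ge> 0" using that by simp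
      show ?thesis
        unfolding Inr mvec_Inr Ah_def Bh_def Nh_def[rule_format]
        using i by (simp add: index_mult_vec_sum[OF blk_carrier xh_dim[OF s] i]
            index_mult_vec_sum[OF blk_carrier u_dim[OF s] i] w_def mult.commute del: index_mult_mat_vec)
    qed
    ultimately show ?thesis by (subst has_integral_cong[symmetric]) (auto simp: Inr z_def)
  qed
  note density = bilinear_solution_density[OF T sol u_abs]
  define \<gamma> where "\<gamma> = (\<Sum>e\<in>I. \<Sum>f\<in>I. ext_P e f * (\<Sum>o'<p. ext_C o' e * ext_C o' f))"
  have N0: "dup (\<lambda>i j. N k $$ (i,j)) e f = 0" if "k < m" "k \<notin> K" "e \<in> I" "f \<in> I" for k e f
    using that r_le by (cases e; cases f) (auto simp: K_def I_def)
  have KT: "K \<subseteq> {..<m}" by (auto simp: K_def)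
  note bound = bilinear_output_bound[where N="\<lambda>k. dup (\<lambda>i j. N k $$ (i,j))",
      OF finite_I T KT N0 density(2) density(1) usq_T ext_lyap ext_S_psd ext_super]
  have \<gamma>0: "0 \<le> \<gamma>" unfolding \<gamma>_def by (rule bound(2))
  define H where "H = L2sq m (\<lambda>k. N k \<noteq> 0\<^sub>m n n) u"
  define U where "U = L2sq m (\<lambda>k. True) u"
  \<comment> \<open>The estimate at time T involves only the control on [0,T]; nonnegative
    integrands allow passage to the half-line, and \<open>\<gamma>0\<close> keeps the product
    monotone.\<close>
  have int_le: "integral {0..T} (\<lambda>s. \<Sum>k\<in>J. (w s k)\<^sup>2) \<le> integral {0..} (\<lambda>s. \<Sum>k\<in>J. (w s k)\<^sup>2)"
    if "J \<subseteq> {..<m}" for J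
  proof (rule integral_subset_le)
    have "finite J" using that finite_subset by blast
    then show "(\<lambda>s. \<Sum>k\<in>J. (w s k)\<^sup>2) integrable_on {0..T}" "(\<lambda>s. \<Sum>k\<in>J. (w s k)\<^sup>2) integrable_on {0..}"
      using that usq usq_T by (auto intro!: set_lebesgue_integral_eq_integral(1) absolutely_integrable_sum)
  qed (auto intro!: sum_nonneg)
  have H: "integral {0..T} (\<lambda>s. \<Sum>k\<in>K. (w s k)\<^sup>2) \<le> H"
    using int_le[OF KT] by (simp add: H_def L2sq_def K_def w_def)
  have U: "integral {0..T} (\<lambda>s. \<Sum>k<m. (w s k)\<^sup>2) \<le> U"
    using int_le[of "{..<m}"] by (simp add: U_def L2sq_def w_def lessThan_def)
  have U0: "0 \<le> integral {0..T} (\<lambda>s. \<Sum>k<m. (w s k)\<^sup>2)"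
    using usq_T by (intro integral_nonneg set_lebesgue_integral_eq_integral(1) absolutely_integrable_sum)
      (auto intro!: sum_nonneg)
  have out: "(C *\<^sub>v x T - Ch *\<^sub>v xh T) $ o' = (\<Sum>e\<in>I. ext_C o' e * z T e)" if "o' < p" for o'
    using that index_mult_vec_sum[OF dims(3) x_dim[OF T] that] dims(3)
      index_mult_vec_sum[of Ch p r, OF _ xh_dim[OF T] that]
    by (simp add: Ch_def sum_I z_def sum_negf blk_def del: index_mult_mat_vec(1))
  have "vnorm2 (C *\<^sub>v x T - Ch *\<^sub>v xh T) = sqrt (\<Sum>o'<p. (\<Sum>e\<in>I. ext_C o' e * z T e)\<^sup>2)"
    using out by (simp add: vnorm2_def Ch_def blk_def)
  also have "\<dots> \<le> sqrt (\<gamma> * exp H * U)"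
  proof (rule real_sqrt_le_mono)
    have "(\<Sum>o'<p. (\<Sum>e\<in>I. ext_C o' e * z T e)\<^sup>2)
        \<le> \<gamma> * exp (integral {0..T} (\<lambda>s. \<Sum>k\<in>K. (w s k)\<^sup>2)) * integral {0..T} (\<lambda>s. \<Sum>k<m. (w s k)\<^sup>2)"
      unfolding \<gamma>_def by (rule bound(1))
    also have "\<dots> \<le> \<gamma> * exp H * U"
      using \<gamma>0 H U U0 by (intro mult_mono) auto
    finally show "(\<Sum>o'<p. (\<Sum>e\<in>I. ext_C o' e * z T e)\<^sup>2) \<le> \<gamma> * exp H * U" .
  qed
  also have "\<dots> = sqrt \<gamma> * exp (0.5 * H) * sqrt U"
  proof -
    have "sqrt (exp H) = exp (0.5 * H)"
      by (rule real_sqrt_unique) (simp_all add: power2_eq_square exp_add[symmetric])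
    then show ?thesis by (simp add: real_sqrt_mult)
  qed
  finally have final: "vnorm2 (C *\<^sub>v x T - Ch *\<^sub>v xh T) \<le> sqrt \<gamma> * exp (0.5 * H) * sqrt U" .

  \<comment> \<open>Identification of the constant with tr (Sigma_2 K_BT)\<close>
  define KBT where "KBT = blk B r 0 (n - r) m * (blk B r 0 (n - r) m)\<^sup>T
         + 2 \<cdot>\<^sub>m (blk Pg r 0 (n - r) r * (blk A r 0 (n - r) r)\<^sup>T)
         + msum (n - r) (n - r) (\<lambda>k.
               2 \<cdot>\<^sub>m (blk (N k) r r (n - r) (n - r) * blk Pg r 0 (n - r) r * (blk (N k) r 0 (n - r) r)\<^sup>T)
             + 2 \<cdot>\<^sub>m (blk (N k) r 0 (n - r) r * blk Pg 0 0 r r * (blk (N k) r 0 (n - r) r)\<^sup>T)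
             - blk (N k) r 0 (n - r) r * Phat * (blk (N k) r 0 (n - r) r)\<^sup>T) m"
  have KBT_dim: "KBT \<in> carrier_mat (n - r) (n - r)" by (simp add: KBT_def msum_def)
  have KBT_entry: "KBT $$ (i,i) = (\<Sum>k<m. B $$ (r + i,k) * B $$ (r + i,k)) + 2 * (\<Sum>l<r. Pg $$ (r + i,l) * A $$ (r + i,l))
      + (\<Sum>k<m. 2 * (\<Sum>l<n. \<Sum>q<r. N k $$ (r + i,l) * Pg $$ (l,q) * N k $$ (r + i,q))
        - (\<Sum>l<r. \<Sum>q<r. N k $$ (r + i,l) * Phat $$ (l,q) * N k $$ (r + i,q)))" if i: "i < n - r" for i
  proof -
    let ?N21 = "\<lambda>k. blk (N k) r 0 (n - r) r" and ?N22 = "\<lambda>k. blk (N k) r r (n - r) (n - r)"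
    have N21t: "(?N21 k)\<^sup>T \<in> carrier_mat r (n - r)" for k by simp
    have 1: "(blk B r 0 (n - r) m * (blk B r 0 (n - r) m)\<^sup>T) $$ (i,i) = (\<Sum>k<m. B $$ (r + i,k) * B $$ (r + i,k))"
      using i by (subst index_mult_mat_sum[of _ "n - r" m _ "n - r"]) (auto simp: blk_def)
    have 2: "(blk Pg r 0 (n - r) r * (blk A r 0 (n - r) r)\<^sup>T) $$ (i,i) = (\<Sum>l<r. Pg $$ (r + i,l) * A $$ (r + i,l))"
      using i by (subst index_mult_mat_sum[of _ "n - r" r _ "n - r"]) (auto simp: blk_def)
    have 3: "(?N22 k * blk Pg r 0 (n - r) r * (?N21 k)\<^sup>T) $$ (i,i)
        = (\<Sum>l=r..<n. \<Sum>q<r. N k $$ (r + i,l) * Pg $$ (l,q) * N k $$ (r + i,q))" for k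
    proof -
      have "(?N22 k * blk Pg r 0 (n - r) r * (?N21 k)\<^sup>T) $$ (i,i)
          = (\<Sum>l<n - r. \<Sum>q<r. N k $$ (r + i,r + l) * Pg $$ (r + l,q) * N k $$ (r + i,q))"
        using i by (subst index_mult_mat3_sum[OF blk_carrier blk_carrier N21t]) (auto simp: blk_def)
      also have "\<dots> = (\<Sum>l=r..<n. \<Sum>q<r. N k $$ (r + i,l) * Pg $$ (l,q) * N k $$ (r + i,q))"
        by (subst sum.atLeastLessThan_shift_0[of _ r n]) (simp add: atLeast0LessThan)
      finally show ?thesis .
    qed
    have 4: "(?N21 k * blk Pg 0 0 r r * (?N21 k)\<^sup>T) $$ (i,i)
        = (\<Sum>l<r. \<Sum>q<r. N k $$ (r + i,l) * Pg $$ (l,q) * N k $$ (r + i,q))" for k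
      using i by (subst index_mult_mat3_sum[OF blk_carrier blk_carrier N21t]) (auto simp: blk_def)
    have 5: "(?N21 k * Phat * (?N21 k)\<^sup>T) $$ (i,i)
        = (\<Sum>l<r. \<Sum>q<r. N k $$ (r + i,l) * Phat $$ (l,q) * N k $$ (r + i,q))" for k
      using i by (subst index_mult_mat3_sum[OF blk_carrier Phat_dim N21t]) (auto simp: blk_def)
    have dimr: "dim_row (blk M a b c d) = c" "dim_col (blk M a b c d) = d" for M a b c d
      by (simp_all add: blk_def)
    \<comment> \<open>The N_22 P_g2 and N_21 P_g1 terms of K_BT are the two halves of one sum: the
      lower rows of N_k applied to all of \<open>Pg\<close>.\<close>
    have 6: "(\<Sum>l<n. \<Sum>q<r. N k $$ (r + i,l) * Pg $$ (l,q) * N k $$ (r + i,q))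
        = (\<Sum>l<r. \<Sum>q<r. N k $$ (r + i,l) * Pg $$ (l,q) * N k $$ (r + i,q))
        + (\<Sum>l=r..<n. \<Sum>q<r. N k $$ (r + i,l) * Pg $$ (l,q) * N k $$ (r + i,q))" for k
      by (rule sum_split)
    show ?thesis
      unfolding KBT_def 6 using i 1 2 3 4 5
      by (simp add: msum_def dimr distrib_left add_ac del: index_mult_mat(1))
  qed
  have "mtrace (mat_diag (n - r) (\<lambda>i. \<sigma> (r + i)) * KBT) = \<gamma>"
  proof -
    have "\<gamma> = (\<Sum>i<n - r. \<sigma> (r + i) * KBT $$ (i,i))"
      unfolding \<gamma>_def pairing_trace
      by (subst sum.atLeastLessThan_shift_0[of _ r n]) (simp add: atLeast0LessThan KBT_entry)
    then show ?thesis by (simp add: mtrace_mat_diag_mult[OF KBT_dim])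
  qed
  with final show "vnorm2 (C *\<^sub>v x T - Ch *\<^sub>v xh T) \<le>
     sqrt (mtrace (mat_diag (n - r) (\<lambda>i. \<sigma> (r + i)) *
        (blk B r 0 (n - r) m * (blk B r 0 (n - r) m)\<^sup>T
         + 2 \<cdot>\<^sub>m (blk Pg r 0 (n - r) r * (blk A r 0 (n - r) r)\<^sup>T)
         + msum (n - r) (n - r) (\<lambda>k.
               2 \<cdot>\<^sub>m (blk (N k) r r (n - r) (n - r) * blk Pg r 0 (n - r) r * (blk (N k) r 0 (n - r) r)\<^sup>T)
             + 2 \<cdot>\<^sub>m (blk (N k) r 0 (n - r) r * blk Pg 0 0 r r * (blk (N k) r 0 (n - r) r)\<^sup>T)
             - blk (N k) r 0 (n - r) r * Phat * (blk (N k) r 0 (n - r) r)\<^sup>T) m)))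
     * exp (0.5 * L2sq m (\<lambda>k. N k \<noteq> 0\<^sub>m n n) u)
     * sqrt (L2sq m (\<lambda>k. True) u)"
    by (simp only: KBT_def[symmetric] H_def[symmetric] U_def[symmetric])
qed

end
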